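(* Let $(\{P^{s,t}\},\omega_0)$ be a quantum quadratic stochastic process of type (A) on a von Neumann algebra $\mathcal{M}$, and let $$Q^{s,t}=E_{\omega_s}P^{s,t}:\mathcal{M}\to\mathcal{M},\qquad H^{s,t}=P^{s,t}E_{\omega_t}:\mathcal{M}\otimes\mathcal{M}\to\mathcal{M}\otimes\mathcal{M}$$ be its marginal Markov processes, and let $Z^{s,t}:\mathcal{M}\otimes\mathcal{M}\to\mathcal{M}\otimes\mathcal{M}$ be given by $Z^{s,t}\mathbf{x}=E_{\omega_s}(H^{s,t}\mathbf{x})\otimes\mathbf{1}$. Then the following conditions are equivalent: (i) $(\{P^{s,t}\},\omega_0)$ satisfies the ergodic principle; (ii) $\{Q^{s,t}\}$ satisfies the ergodic principle; (iii) $\{H^{s,t}\}$ satisfies the ergodic principle; (iv) $\{Z^{s,t}\}$ satisfies the ergodic principle.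
   Context: $\mathcal{M}\otimes\mathcal{M}$ is the von Neumann algebra tensor product and $\mathbf{1}$ is the unit of $\mathcal{M}$. $U:\mathcal{M}\otimes\mathcal{M}\to\mathcal{M}\otimes\mathcal{M}$ is the flip, the ultraweakly continuous linear map with $U(x\otimes y)=y\otimes x$. For a normal state $\varphi$ on $\mathcal{M}$, $E_\varphi:\mathcal{M}\otimes\mathcal{M}\to\mathcal{M}$ is the slice map determined by $E_\varphi(a\otimes b)=\varphi(b)a$, extended by linearity and ultraweak continuity. $S$ and $S^2$ denote the sets of normal states on $\mathcal{M}$ and on $\mathcal{M}\otimes\mathcal{M}$, respectively. A quantum quadratic stochastic process of type (A) on $\mathcal{M}$ is a pair $(\{P^{s,t}\},\omega_0)$, where $\omega_0\in S$ and $\{P^{s,t}:\mathcal{M}\to\mathcal{M}\otimes\mathcal{M}: s,t\in\mathbb{R}_+,\ t-s\ge1\}$ is a family of ultraweakly continuous, unital, completely positive linear maps with $UP^{s,t}=P^{s,t}$, such that for all $s,\tau,t\in\mathbb{R}_+$ with $\tau-s\ge1$, $t-\tau\ge1$ one has $P^{s,t}x=P^{s,\tau}(E_{\omega_\tau}(P^{\tau,t}x))$ for all $x\in\mathcal{M}$, where $\omega_\tau(x)=(\omega_0\otimes\omega_0)(P^{0,\tau}x)$ for $\tau\ge1$ (and $\omega_\tau$ at $\tau=0$ is the initial state $\omega_0$). For an ultraweakly continuous linear map $T$, $T_*$ denotes the predual map $T_*\varphi=\varphi\circ T$ on normal functionals, and $\|\cdot\|_1$ is the norm of functionals. The process $(\{P^{s,t}\},\omega_0)$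 satisfies the ergodic principle if $\lim_{t\to\infty}\|P^{s,t}_*\varphi-P^{s,t}_*\psi\|_1=0$ for all $\varphi,\psi\in S^2$ and all $s\in\mathbb{R}_+$. A family $\{T^{s,t}\}$ of ultraweakly continuous unital completely positive maps of a von Neumann algebra $\mathcal{N}$ into itself satisfies the ergodic principle if $\lim_{t\to\infty}\|T^{s,t}_*\varphi-T^{s,t}_*\psi\|_1=0$ for all normal states $\varphi,\psi$ on $\mathcal{N}$ and all initial times $s$ for which the family is defined. The family $\{H^{s,t}\}$ is defined for $s\in\mathbb{R}_+$, $t-s\ge1$; the families $\{Q^{s,t}\}$ and $\{Z^{s,t}\}$, whose definition involves $\omega_s$, are defined for $s\in\{0\}\cup[1,\infty)$, $t-s\ge1$. *)

theory Defs
  imports "HOL-Analysis.Analysis"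
begin

section \<open>Complex Hilbert spaces\<close>

class scaleC =
  fixes scaleC :: "complex \<Rightarrow> 'a \<Rightarrow> 'a" (infixr "*\<^sub>C" 75)

class complex_vector = scaleC + real_vector +
  assumes scaleC_add_right: "c *\<^sub>C (x + y) = c *\<^sub>C x + c *\<^sub>C y"
    and scaleC_add_left: "(c + d) *\<^sub>C x = c *\<^sub>C x + d *\<^sub>C x"
    and scaleC_scaleC: "c *\<^sub>C d *\<^sub>C x = (c * d) *\<^sub>C x"
    and scaleC_one: "1 *\<^sub>C x = x"
    and scaleR_scaleC: "r *\<^sub>R x = complex_of_real r *\<^sub>C x"

text \<open>The inner product is linear in the first argument.\<close>

class complex_inner = complex_vector + real_normed_vector +
  fixes cinner :: "'a \<Rightarrow> 'a \<Rightarrow> complex"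
  assumes cinner_commute: "cinner x y = cnj (cinner y x)"
    and cinner_add_left: "cinner (x + y) z = cinner x z + cinner y z"
    and cinner_scaleC_left: "cinner (c *\<^sub>C x) y = c * cinner x y"
    and cinner_self_nonneg: "cinner x x \<in> \<real>\<^sub>\<ge>\<^sub>0"
    and norm_eq_sqrt_cinner: "norm x = sqrt (Re (cinner x x))"

class complex_hilbert_space = complex_inner + banach

interpretation complex_vector: vector_space "scaleC :: complex \<Rightarrow> 'a \<Rightarrow> 'a::complex_vector"
  by unfold_locales (simp_all add: scaleC_add_right scaleC_add_left scaleC_scaleC scaleC_one)

lemma norm_scaleC: "norm (c *\<^sub>C x) = cmod c * norm (x::'a::complex_inner)"
proof -
  have "cinner x (c *\<^sub>C x) = cnj c * cinner x x"
    by (metis cinner_commute cinner_scaleC_left complex_cnj_mult)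
  then have "cinner (c *\<^sub>C x) (c *\<^sub>C x) = (c * cnj c) * cinner x x"
    by (simp add: cinner_scaleC_left)
  also have "c * cnj c = complex_of_real ((cmod c)\<^sup>2)"
    by (simp only: complex_norm_square)
  finally have "Re (cinner (c *\<^sub>C x) (c *\<^sub>C x)) = (cmod c)\<^sup>2 * Re (cinner x x)"
    by (simp del: of_real_power)
  then show ?thesis
    by (simp add: norm_eq_sqrt_cinner real_sqrt_mult)
qed

instantiation complex :: complex_hilbert_space
begin

definition scaleC_complex :: "complex \<Rightarrow> complex \<Rightarrow> complex"
  where "scaleC_complex c x = c * x"

definition cinner_complex :: "complex \<Rightarrow> complex \<Rightarrow> complex"
  where "cinner_complex x y = x * cnj y"

instance
proof
  fix x y z c d :: complex and r :: real
  show "cinner x x \<in> \<real>\<^sub>\<ge>\<^sub>0"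
    unfolding cinner_complex_def by (simp add: complex_nonneg_Reals_iff)
  show "norm x = sqrt (Re (cinner x x))"
    by (simp add: cinner_complex_def cmod_def power2_eq_square)
qed (simp_all add: scaleC_complex_def cinner_complex_def algebra_simps scaleR_conv_of_real)

end


section \<open>Operators\<close>

text \<open>The type \<open>'a \<Rightarrow>\<^sub>L 'b\<close> consists of the bounded \<^emph>\<open>real\<close>-linear maps, so
  the algebra of bounded complex-linear operators is a proper subset of it.\<close>

instantiation blinfun :: (real_normed_vector, complex_inner) complex_vector
begin

lift_definition scaleC_blinfun :: "complex \<Rightarrow> ('a \<Rightarrow>\<^sub>L 'b) \<Rightarrow> ('a \<Rightarrow>\<^sub>L 'b)"
  is "\<lambda>c f x. c *\<^sub>C f x"
proof -
  fix c :: complex and f :: "'a \<Rightarrow> 'b"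
  assume "bounded_linear f"
  then interpret f: bounded_linear f .
  show "bounded_linear (\<lambda>x. c *\<^sub>C f x)"
  proof
    fix x y r
    show "c *\<^sub>C f (x + y) = c *\<^sub>C f x + c *\<^sub>C f y"
      by (simp add: f.add scaleC_add_right)
    show "c *\<^sub>C f (r *\<^sub>R x) = r *\<^sub>R c *\<^sub>C f x"
      by (simp add: f.scaleR scaleR_scaleC scaleC_scaleC mult.commute)
    obtain K where K: "\<And>x. norm (f x) \<le> norm x * K"
      using f.bounded by blast
    have "norm (c *\<^sub>C f x) \<le> norm x * (cmod c * K)" for x
      using mult_left_mono[OF K[of x], of "cmod c"] by (simp add: norm_scaleC mult_ac)
    then show "\<exists>K. \<forall>x. norm (c *\<^sub>C f x) \<le> norm x * K"
      by blast
  qed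
qed

instance
  by standard
    (transfer; simp add: scaleC_add_right scaleC_add_left scaleC_scaleC scaleC_one scaleR_scaleC)+

end

definition bounded_ops :: "('h::complex_hilbert_space \<Rightarrow>\<^sub>L 'h) set"
  where "bounded_ops = {x. \<forall>c h. blinfun_apply x (c *\<^sub>C h) = c *\<^sub>C blinfun_apply x h}"

definition adj :: "('h::complex_hilbert_space \<Rightarrow>\<^sub>L 'h) \<Rightarrow> ('h \<Rightarrow>\<^sub>L 'h)"
  where "adj x = (THE y. \<forall>h k. cinner (blinfun_apply x h) k = cinner h (blinfun_apply y k))"

text \<open>The coarsest topology making the functionals in \<open>F\<close> continuous.\<close>

definition initial_topology :: "('a \<Rightarrow> complex) set \<Rightarrow> 'a topology"
  where "initial_topology F = topology_generated_by {f -` U | f U. f \<in> F \<and> open U}"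

definition weak_op_topology :: "('h::complex_hilbert_space \<Rightarrow>\<^sub>L 'h) topology"
  where "weak_op_topology =
    subtopology
      (initial_topology {(\<lambda>x. cinner (blinfun_apply x \<xi>) \<eta>) | \<xi> \<eta>. True})
      bounded_ops"

definition ultraweak_topology :: "('h::complex_hilbert_space \<Rightarrow>\<^sub>L 'h) topology"
  where "ultraweak_topology =
    subtopology
      (initial_topology
        {(\<lambda>x. \<Sum>n. cinner (blinfun_apply x (\<xi> n)) (\<eta> n)) | \<xi> \<eta> :: nat \<Rightarrow> 'h.
          summable (\<lambda>n. (norm (\<xi> n))\<^sup>2) \<and> summable (\<lambda>n. (norm (\<eta> n))\<^sup>2)})
      bounded_ops"

definition von_neumann_algebra :: "('h::complex_hilbert_space \<Rightarrow>\<^sub>L 'h) set \<Rightarrow> bool"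
  where "von_neumann_algebra M \<longleftrightarrow>
    M \<subseteq> bounded_ops \<and> complex_vector.subspace M \<and> id_blinfun \<in> M \<and>
    (\<forall>x\<in>M. \<forall>y\<in>M. x o\<^sub>L y \<in> M) \<and> (\<forall>x\<in>M. adj x \<in> M) \<and>
    closedin weak_op_topology M"


section \<open>Maps and functionals\<close>

text \<open>Maps between algebras and functionals on an algebra are total functions on the
  ambient operator type; only their values on the given algebra are meaningful.\<close>

definition linear_on :: "'a::complex_vector set \<Rightarrow> ('a \<Rightarrow> 'b::complex_vector) \<Rightarrow> bool"
  where "linear_on M T \<longleftrightarrow>
    (\<forall>x\<in>M. \<forall>y\<in>M. T (x + y) = T x + T y) \<and> (\<forall>c. \<forall>x\<in>M. T (c *\<^sub>C x) = c *\<^sub>C T x)"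

definition normal_map ::
    "('h::complex_hilbert_space \<Rightarrow>\<^sub>L 'h) set \<Rightarrow> ('k::complex_hilbert_space \<Rightarrow>\<^sub>L 'k) set
      \<Rightarrow> (('h \<Rightarrow>\<^sub>L 'h) \<Rightarrow> ('k \<Rightarrow>\<^sub>L 'k)) \<Rightarrow> bool"
  where "normal_map M N T \<longleftrightarrow>
    T \<in> M \<rightarrow> N \<and> linear_on M T \<and>
    continuous_map (subtopology ultraweak_topology M) (subtopology ultraweak_topology N) T"

definition normal_functional ::
    "('h::complex_hilbert_space \<Rightarrow>\<^sub>L 'h) set \<Rightarrow> (('h \<Rightarrow>\<^sub>L 'h) \<Rightarrow> complex) \<Rightarrow> bool"
  where "normal_functional M \<phi> \<longleftrightarrow>
    linear_on M \<phi> \<and> continuous_map (subtopology ultraweak_topology M) euclidean \<phi>"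

text \<open>Positivity of the operator matrix \<open>(X i j)\<close>, \<open>i, j < n\<close>, acting on the \<open>n\<close>-fold
  direct sum of the Hilbert space.\<close>

definition pos_matrix :: "nat \<Rightarrow> (nat \<Rightarrow> nat \<Rightarrow> ('h::complex_hilbert_space \<Rightarrow>\<^sub>L 'h)) \<Rightarrow> bool"
  where "pos_matrix n X \<longleftrightarrow>
    (\<forall>h. (\<Sum>i<n. cinner (\<Sum>j<n. blinfun_apply (X i j) (h j)) (h i)) \<in> \<real>\<^sub>\<ge>\<^sub>0)"

definition pos_op :: "('h::complex_hilbert_space \<Rightarrow>\<^sub>L 'h) \<Rightarrow> bool"
  where "pos_op x \<longleftrightarrow> (\<forall>h. cinner (blinfun_apply x h) h \<in> \<real>\<^sub>\<ge>\<^sub>0)"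

definition completely_positive ::
    "('h::complex_hilbert_space \<Rightarrow>\<^sub>L 'h) set
      \<Rightarrow> (('h \<Rightarrow>\<^sub>L 'h) \<Rightarrow> ('k::complex_hilbert_space \<Rightarrow>\<^sub>L 'k)) \<Rightarrow> bool"
  where "completely_positive M T \<longleftrightarrow>
    (\<forall>n X. (\<forall>i<n. \<forall>j<n. X i j \<in> M) \<and> pos_matrix n X \<longrightarrow> pos_matrix n (\<lambda>i j. T (X i j)))"

definition normal_states ::
    "('h::complex_hilbert_space \<Rightarrow>\<^sub>L 'h) set \<Rightarrow> (('h \<Rightarrow>\<^sub>L 'h) \<Rightarrow> complex) set"
  where "normal_states M =
    {\<phi>. normal_functional M \<phi> \<and> (\<forall>x\<in>M. pos_op x \<longrightarrow> \<phi> x \<in> \<real>\<^sub>\<ge>\<^sub>0) \<and> \<phi> id_blinfun = 1}"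

definition functional_norm ::
    "('h::complex_hilbert_space \<Rightarrow>\<^sub>L 'h) set \<Rightarrow> (('h \<Rightarrow>\<^sub>L 'h) \<Rightarrow> complex) \<Rightarrow> real"
  where "functional_norm M f = (SUP x\<in>{x\<in>M. norm x \<le> 1}. cmod (f x))"

definition predual :: "('a \<Rightarrow> 'b) \<Rightarrow> ('b \<Rightarrow> complex) \<Rightarrow> ('a \<Rightarrow> complex)"
  where "predual T \<phi> = \<phi> \<circ> T"


section \<open>Tensor products\<close>

text \<open>The Hilbert tensor product of \<open>'h\<close> and \<open>'k\<close>, characterised up to a unique unitary:
  a Hilbert space \<open>'t\<close> with a bilinear map \<open>t\<close> that is multiplicative on inner products and has
  total range.\<close>

definition hilbert_tensor ::
    "('h::complex_hilbert_space \<Rightarrow> 'k::complex_hilbert_space \<Rightarrow> 't::complex_hilbert_space) \<Rightarrow> bool"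
  where "hilbert_tensor t \<longleftrightarrow>
    (\<forall>y. linear_on UNIV (\<lambda>x. t x y)) \<and> (\<forall>x. linear_on UNIV (t x)) \<and>
    (\<forall>x y x' y'. cinner (t x y) (t x' y') = cinner x x' * cinner y y') \<and>
    closure (complex_vector.span {t x y | x y. True}) = UNIV"

definition tensor_op ::
    "('h::complex_hilbert_space \<Rightarrow> 'k::complex_hilbert_space \<Rightarrow> 't::complex_hilbert_space)
      \<Rightarrow> ('h \<Rightarrow>\<^sub>L 'h) \<Rightarrow> ('k \<Rightarrow>\<^sub>L 'k) \<Rightarrow> ('t \<Rightarrow>\<^sub>L 't)"
  where "tensor_op t a b =
    (THE c. c \<in> bounded_ops \<and>
      (\<forall>x y. blinfun_apply c (t x y) = t (blinfun_apply a x) (blinfun_apply b y)))"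

text \<open>The von Neumann algebra tensor product: the ultraweak closure of the algebraic one.\<close>

definition vn_tensor ::
    "('h::complex_hilbert_space \<Rightarrow> 'k::complex_hilbert_space \<Rightarrow> 't::complex_hilbert_space)
      \<Rightarrow> ('h \<Rightarrow>\<^sub>L 'h) set \<Rightarrow> ('k \<Rightarrow>\<^sub>L 'k) set \<Rightarrow> ('t \<Rightarrow>\<^sub>L 't) set"
  where "vn_tensor t M N =
    ultraweak_topology closure_of complex_vector.span {tensor_op t a b | a b. a \<in> M \<and> b \<in> N}"

text \<open>In the next three definitions linearity and ultraweak continuity determine the chosen map
  on the tensor product; the choice is arbitrary only off it.\<close>

definition flip ::
    "('h::complex_hilbert_space \<Rightarrow> 'h \<Rightarrow> 't::complex_hilbert_space)
      \<Rightarrow> ('h \<Rightarrow>\<^sub>L 'h) set \<Rightarrow> ('t \<Rightarrow>\<^sub>L 't) \<Rightarrow> ('t \<Rightarrow>\<^sub>L 't)"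
  where "flip t M =
    (SOME U. normal_map (vn_tensor t M M) (vn_tensor t M M) U \<and>
      (\<forall>x\<in>M. \<forall>y\<in>M. U (tensor_op t x y) = tensor_op t y x))"

definition slice ::
    "('h::complex_hilbert_space \<Rightarrow> 'h \<Rightarrow> 't::complex_hilbert_space)
      \<Rightarrow> ('h \<Rightarrow>\<^sub>L 'h) set \<Rightarrow> (('h \<Rightarrow>\<^sub>L 'h) \<Rightarrow> complex) \<Rightarrow> ('t \<Rightarrow>\<^sub>L 't) \<Rightarrow> ('h \<Rightarrow>\<^sub>L 'h)"
  where "slice t M \<phi> =
    (SOME E. normal_map (vn_tensor t M M) M E \<and>
      (\<forall>a\<in>M. \<forall>b\<in>M. E (tensor_op t a b) = \<phi> b *\<^sub>C a))"

definition product_functional ::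
    "('h::complex_hilbert_space \<Rightarrow> 'h \<Rightarrow> 't::complex_hilbert_space)
      \<Rightarrow> ('h \<Rightarrow>\<^sub>L 'h) set \<Rightarrow> (('h \<Rightarrow>\<^sub>L 'h) \<Rightarrow> complex) \<Rightarrow> (('h \<Rightarrow>\<^sub>L 'h) \<Rightarrow> complex)
      \<Rightarrow> ('t \<Rightarrow>\<^sub>L 't) \<Rightarrow> complex"
  where "product_functional t M \<phi> \<psi> =
    (SOME f. normal_functional (vn_tensor t M M) f \<and>
      (\<forall>a\<in>M. \<forall>b\<in>M. f (tensor_op t a b) = \<phi> a * \<psi> b))"


section \<open>Quantum quadratic stochastic processes\<close>

definition omega ::
    "('h::complex_hilbert_space \<Rightarrow> 'h \<Rightarrow> 't::complex_hilbert_space) \<Rightarrow> ('h \<Rightarrow>\<^sub>L 'h) set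
      \<Rightarrow> (real \<Rightarrow> real \<Rightarrow> ('h \<Rightarrow>\<^sub>L 'h) \<Rightarrow> ('t \<Rightarrow>\<^sub>L 't)) \<Rightarrow> (('h \<Rightarrow>\<^sub>L 'h) \<Rightarrow> complex)
      \<Rightarrow> real \<Rightarrow> ('h \<Rightarrow>\<^sub>L 'h) \<Rightarrow> complex"
  where "omega t M P \<omega>0 \<tau> =
    (if \<tau> = 0 then \<omega>0 else (\<lambda>x. product_functional t M \<omega>0 \<omega>0 (P 0 \<tau> x)))"

definition qqsp_A ::
    "('h::complex_hilbert_space \<Rightarrow> 'h \<Rightarrow> 't::complex_hilbert_space) \<Rightarrow> ('h \<Rightarrow>\<^sub>L 'h) set
      \<Rightarrow> (real \<Rightarrow> real \<Rightarrow> ('h \<Rightarrow>\<^sub>L 'h) \<Rightarrow> ('t \<Rightarrow>\<^sub>L 't)) \<Rightarrow> (('h \<Rightarrow>\<^sub>L 'h) \<Rightarrow> complex) \<Rightarrow> bool"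
  where "qqsp_A t M P \<omega>0 \<longleftrightarrow>
    \<omega>0 \<in> normal_states M \<and>
    (\<forall>s u. 0 \<le> s \<and> u - s \<ge> 1 \<longrightarrow>
      normal_map M (vn_tensor t M M) (P s u) \<and>
      P s u id_blinfun = id_blinfun \<and>
      completely_positive M (P s u) \<and>
      (\<forall>x\<in>M. flip t M (P s u x) = P s u x)) \<and>
    (\<forall>s \<tau> u. 0 \<le> s \<and> \<tau> - s \<ge> 1 \<and> u - \<tau> \<ge> 1 \<longrightarrow>
      (\<forall>x\<in>M. P s u x = P s \<tau> (slice t M (omega t M P \<omega>0 \<tau>) (P \<tau> u x))))"

definition Q_process ::
    "('h::complex_hilbert_space \<Rightarrow> 'h \<Rightarrow> 't::complex_hilbert_space) \<Rightarrow> ('h \<Rightarrow>\<^sub>L 'h) set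
      \<Rightarrow> (real \<Rightarrow> real \<Rightarrow> ('h \<Rightarrow>\<^sub>L 'h) \<Rightarrow> ('t \<Rightarrow>\<^sub>L 't)) \<Rightarrow> (('h \<Rightarrow>\<^sub>L 'h) \<Rightarrow> complex)
      \<Rightarrow> real \<Rightarrow> real \<Rightarrow> ('h \<Rightarrow>\<^sub>L 'h) \<Rightarrow> ('h \<Rightarrow>\<^sub>L 'h)"
  where "Q_process t M P \<omega>0 s u x = slice t M (omega t M P \<omega>0 s) (P s u x)"

definition H_process ::
    "('h::complex_hilbert_space \<Rightarrow> 'h \<Rightarrow> 't::complex_hilbert_space) \<Rightarrow> ('h \<Rightarrow>\<^sub>L 'h) set
      \<Rightarrow> (real \<Rightarrow> real \<Rightarrow> ('h \<Rightarrow>\<^sub>L 'h) \<Rightarrow> ('t \<Rightarrow>\<^sub>L 't)) \<Rightarrow> (('h \<Rightarrow>\<^sub>L 'h) \<Rightarrow> complex)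
      \<Rightarrow> real \<Rightarrow> real \<Rightarrow> ('t \<Rightarrow>\<^sub>L 't) \<Rightarrow> ('t \<Rightarrow>\<^sub>L 't)"
  where "H_process t M P \<omega>0 s u x = P s u (slice t M (omega t M P \<omega>0 u) x)"

definition Z_process ::
    "('h::complex_hilbert_space \<Rightarrow> 'h \<Rightarrow> 't::complex_hilbert_space) \<Rightarrow> ('h \<Rightarrow>\<^sub>L 'h) set
      \<Rightarrow> (real \<Rightarrow> real \<Rightarrow> ('h \<Rightarrow>\<^sub>L 'h) \<Rightarrow> ('t \<Rightarrow>\<^sub>L 't)) \<Rightarrow> (('h \<Rightarrow>\<^sub>L 'h) \<Rightarrow> complex)
      \<Rightarrow> real \<Rightarrow> real \<Rightarrow> ('t \<Rightarrow>\<^sub>L 't) \<Rightarrow> ('t \<Rightarrow>\<^sub>L 't)"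
  where "Z_process t M P \<omega>0 s u x =
    tensor_op t (slice t M (omega t M P \<omega>0 s) (H_process t M P \<omega>0 s u x)) id_blinfun"

text \<open>For maps \<open>T s u : M \<rightarrow> N\<close> with initial times \<open>s\<close> in \<open>I\<close>, so that \<open>T s u\<close> has a
  predual map from the functionals on \<open>N\<close> to those on \<open>M\<close>. This covers both the quadratic process
  (\<open>N\<close> the tensor square of \<open>M\<close>) and families of maps of an algebra into itself (\<open>N = M\<close>).\<close>

definition ergodic_principle ::
    "real set \<Rightarrow> ('h::complex_hilbert_space \<Rightarrow>\<^sub>L 'h) set \<Rightarrow> ('k::complex_hilbert_space \<Rightarrow>\<^sub>L 'k) set
      \<Rightarrow> (real \<Rightarrow> real \<Rightarrow> ('h \<Rightarrow>\<^sub>L 'h) \<Rightarrow> ('k \<Rightarrow>\<^sub>L 'k)) \<Rightarrow> bool"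
  where "ergodic_principle I M N T \<longleftrightarrow>
    (\<forall>\<phi>\<in>normal_states N. \<forall>\<psi>\<in>normal_states N. \<forall>s\<in>I.
      ((\<lambda>u. functional_norm M (predual (T s u) \<phi> - predual (T s u) \<psi>)) \<longlongrightarrow> 0) at_top)"

end

theory Submission
  imports Defs
begin

text \<open>
  Write \<open>E\<^sub>\<omega>\<close> for the slice map of a normal state \<open>\<omega>\<close>. The four families of maps
  factor through one another. A factor on the left acts on functionals, and must take normal states to
  normal states; a factor on the right acts on arguments, and must not increase norms:
  \<^item> \<open>Q s u = E\<^bsub>\<omega> s\<^esub> \<circ> P s u\<close>, and \<open>\<phi> \<circ> E\<^bsub>\<omega> s\<^esub>\<close> is a normal state, so ergodicity of \<open>P\<close> gives that of \<open>Q\<close>;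
    conversely the evolution equation reads \<open>P s u = P s (s + 1) \<circ> Q (s + 1) u\<close>, and \<open>\<phi> \<circ> P s (s + 1)\<close>
    is a normal state.
  \<^item> \<open>H s u = P s u \<circ> E\<^bsub>\<omega> u\<^esub>\<close> with \<open>E\<^bsub>\<omega> u\<^esub>\<close> contractive, and \<open>H s u (x \<otimes> 1) = P s u x\<close>.
  \<^item> \<open>Z s u = (\<cdot> \<otimes> 1) \<circ> E\<^bsub>\<omega> s\<^esub> \<circ> H s u\<close>, and composing a normal state with \<open>(\<cdot> \<otimes> 1) \<circ> E\<^bsub>\<omega> s\<^esub>\<close> gives a normal
    state; conversely \<open>E\<^bsub>\<omega> 0\<^esub> (Z s u (x \<otimes> 1)) = Q s u x\<close>.

  The substance lies in the properties of slice maps and amplifications that this uses. An ultraweakly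
  continuous functional on \<open>M\<close> is a series \<open>\<Sum>n. \<langle>a \<xi>\<^sub>n, \<eta>\<^sub>n\<rangle>\<close> with square-summable vectors
  (\<open>normal_functional_nuclear\<close>), and such functionals can be summed as long as bounds
  for their vectors are summable (\<open>nuclear_on_suminf\<close>). For \<open>x\<close>, \<open>y\<close> in the Hilbert space let \<open>G\<^sub>x\<^sub>,\<^sub>y(T)\<close> be the operator with
  \<open>\<langle>G\<^sub>x\<^sub>,\<^sub>y(T) \<xi>, \<eta>\<rangle> = \<langle>T (x \<otimes> \<xi>), y \<otimes> \<eta>\<rangle>\<close> (\<open>vector_slice\<close>); it lies in \<open>M\<close> for \<open>T\<close> in the tensor square, since
  this is so for simple tensors and \<open>G\<^sub>x\<^sub>,\<^sub>y\<close> is ultraweakly continuous. Then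
  \<open>\<langle>E\<^sub>\<omega>(T) x, y\<rangle> = \<omega>(G\<^sub>x\<^sub>,\<^sub>y(T))\<close> both constructs \<open>E\<^sub>\<omega>\<close> and shows that it is positive
  (as \<open>G\<^sub>x\<^sub>,\<^sub>x(T) \<ge> 0\<close> when \<open>T \<ge> 0\<close>) and contractive (as \<open>\<omega>\<close> is). Normality of \<open>a \<mapsto> a \<otimes> 1\<close> rests on a Gram--Schmidt expansion of the
  vectors of the algebraic tensor product (\<open>orthogonal_expansion\<close>).
\<close>

section \<open>Bounded operators on a complex Hilbert space\<close>

lemma cinner_add_right: "cinner x (y + z) = cinner x y + cinner x (z::'a::complex_inner)"
  by (metis cinner_add_left cinner_commute complex_cnj_add)

lemma cinner_scaleC_right: "cinner x (c *\<^sub>C y) = cnj c * cinner x (y::'a::complex_inner)"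
  by (metis cinner_commute cinner_scaleC_left complex_cnj_mult)

lemma cinner_scaleR_left: "cinner (r *\<^sub>R x) y = r *\<^sub>R cinner x (y::'a::complex_inner)"
  by (simp add: scaleR_scaleC[of r x] cinner_scaleC_left scaleR_conv_of_real)

lemma cinner_scaleR_right: "cinner x (r *\<^sub>R y) = r *\<^sub>R cinner x (y::'a::complex_inner)"
  by (simp add: scaleR_scaleC[of r y] cinner_scaleC_right scaleR_conv_of_real)

lemma cinner_self: "cinner x x = complex_of_real ((norm (x::'a::complex_inner))\<^sup>2)"
proof -
  obtain r where r: "r \<ge> 0" "cinner x x = complex_of_real r"
    using cinner_self_nonneg[of x] by (auto elim: nonneg_Reals_cases)
  then show ?thesis by (simp add: norm_eq_sqrt_cinner)
qed

lemma Cauchy_Schwarz: "cmod (cinner x y) \<le> norm x * norm (y::'a::complex_inner)"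
proof (cases "y = 0")
  case True
  have "cinner x (0 *\<^sub>C y) = 0" by (simp only: cinner_scaleC_right complex_cnj_zero mult_zero_left)
  with True show ?thesis by simp
next
  case False
  define c where "c = cinner x y / (norm y)\<^sup>2"
  define z where "z = x - c *\<^sub>C y"
  have cy: "c * (complex_of_real (norm y))\<^sup>2 = cinner x y"
    using False by (simp add: c_def)
  have "x = z + c *\<^sub>C y"
    by (simp add: z_def)
  then have "cinner x y = cinner z y + c * cinner y y"
    by (metis cinner_add_left cinner_scaleC_left)
  then have zy: "cinner z y = 0"
    using cy by (simp add: cinner_self)
  from \<open>x = z + c *\<^sub>C y\<close>
  have "cinner x x = cinner (z + c *\<^sub>C y) (z + c *\<^sub>C y)" by simp
  also have "\<dots> = cinner z z + c * cnj c * cinner y y"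
    using zy by (simp add: cinner_add_left cinner_add_right cinner_scaleC_left
        cinner_scaleC_right) (metis cinner_commute complex_cnj_zero mult_zero_right)
  also have "\<dots> = complex_of_real ((norm z)\<^sup>2 + (cmod c)\<^sup>2 * (norm y)\<^sup>2)"
    by (simp add: cinner_self flip: complex_norm_square)
  finally have "(norm x)\<^sup>2 = (norm z)\<^sup>2 + (cmod c)\<^sup>2 * (norm y)\<^sup>2"
    unfolding cinner_self of_real_eq_iff .
  then have "(cmod c * norm y)\<^sup>2 \<le> (norm x)\<^sup>2"
    by (simp add: power_mult_distrib)
  then have "cmod c * norm y \<le> norm x"
    by (rule power2_le_imp_le) simp
  then have "cmod c * norm y * norm y \<le> norm x * norm y"
    by (simp add: mult_right_mono)
  moreover have "cmod (cinner x y) = cmod c * norm y * norm y"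
    unfolding cy[symmetric] by (simp add: norm_mult norm_power power2_eq_square)
  ultimately show ?thesis by simp
qed

interpretation cinner: bounded_bilinear "cinner :: 'a::complex_inner \<Rightarrow> 'a \<Rightarrow> complex"
  by unfold_locales
    (auto simp: cinner_add_left cinner_add_right cinner_scaleR_left cinner_scaleR_right
      intro!: exI[of _ 1] Cauchy_Schwarz)

lemma cinner_right_ext:
  assumes "\<And>z. cinner z x = cinner z (y::'a::complex_inner)"
  shows "x = y"
proof -
  have "cinner (x - y) (x - y) = 0" using assms by (simp add: cinner.diff_right)
  then show ?thesis by (simp add: cinner_self)
qed

lemma cinner_left_ext:
  assumes "\<And>z. cinner x z = cinner (y::'a::complex_inner) z"
  shows "x = y"
  by (rule cinner_right_ext) (metis assms cinner_commute)

lemma norm_add_square: "(norm (x + y))\<^sup>2 = (norm x)\<^sup>2 + 2 * Re (cinner x y) + (norm (y::'a::complex_inner))\<^sup>2"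
proof -
  have "complex_of_real ((norm (x + y))\<^sup>2) = cinner x x + (cinner x y + cnj (cinner x y)) + cinner y y"
    unfolding cinner_self[symmetric] by (simp add: cinner_add_left cinner_add_right flip: cinner_commute)
  also have "\<dots> = complex_of_real ((norm x)\<^sup>2 + 2 * Re (cinner x y) + (norm y)\<^sup>2)"
    by (simp add: cinner_self complex_add_cnj)
  finally show ?thesis unfolding of_real_eq_iff .
qed

text \<open>Riesz representation: the functional \<open>J x = \<parallel>x\<parallel>\<^sup>2 - 2 Re (f x)\<close> is bounded below and, by
  the parallelogram law, uniformly convex, so minimising sequences converge. Stationarity of \<open>J\<close>
  at its minimiser \<open>v\<close> says \<open>Re (f y) = Re \<langle>y, v\<rangle>\<close> for all \<open>y\<close>.\<close>

lemma Riesz_representation: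
  fixes f :: "'h::complex_hilbert_space \<Rightarrow> complex"
  assumes add: "\<And>x y. f (x + y) = f x + f y" and scale: "\<And>c x. f (c *\<^sub>C x) = c * f x"
    and bound: "\<And>x. cmod (f x) \<le> K * norm x"
  obtains v where "\<And>x. f x = cinner x v"
proof -
  have bl: "bounded_linear f"
    by (rule bounded_linear_intro[where K=K])
      (use add scale bound in \<open>auto simp: scaleR_scaleC[where 'a='h] scaleR_conv_of_real mult.commute\<close>)
  interpret f: bounded_linear f by (fact bl)
  define J where "J x = (norm x)\<^sup>2 - 2 * Re (f x)" for x
  have Jlow: "J x \<ge> - K\<^sup>2" for x
  proof -
    have "Re (f x) \<le> K * norm x" using bound[of x] complex_Re_le_cmod[of "f x"] by linarith
    moreover have "0 \<le> (norm x - K)\<^sup>2" by simp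
    ultimately show ?thesis unfolding J_def by (simp add: power2_diff algebra_simps)
  qed
  then have bdd: "bdd_below (range J)" by (rule bdd_belowI2)
  define d where "d = (INF x. J x)"
  have dle: "d \<le> J x" for x unfolding d_def by (rule cINF_lower[OF bdd]) simp
  have "\<exists>x. J x < d + inverse (Suc n)" for n
    using cInf_lessD[of "range J" "d + inverse (Suc n)"] by (auto simp: d_def)
  then obtain X where X: "\<And>n. J (X n) < d + inverse (Suc n)" by metis
  have par: "(norm (x - y))\<^sup>2 \<le> 2 * (J x - d) + 2 * (J y - d)" for x y
  proof -
    have a: "(norm (x + y))\<^sup>2 + (norm (x - y))\<^sup>2 = 2 * (norm x)\<^sup>2 + 2 * (norm y)\<^sup>2"
      using norm_add_square[of x y] norm_add_square[of x "- y"]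
      by (simp only: cinner.minus_right diff_conv_add_uminus norm_minus_cancel uminus_complex.sel)
    have b: "4 * J ((1/2) *\<^sub>R (x + y)) = (norm (x + y))\<^sup>2 - 4 * Re (f x) - 4 * Re (f y)"
      by (simp add: J_def f.scaleR f.add power2_eq_square add_divide_distrib)
    show ?thesis using a b dle[of "(1/2) *\<^sub>R (x + y)"] by (simp add: J_def)
  qed
  have "Cauchy X"
  proof (rule metric_CauchyI)
    fix e :: real assume e: "e > 0"
    then obtain N where N: "inverse (Suc N) < e\<^sup>2 / 4"
      using reals_Archimedean[of "e\<^sup>2/4"] by auto
    have "dist (X m) (X n) < e" if "m \<ge> N" "n \<ge> N" for m n
    proof -
      have *: "J (X k) - d < e\<^sup>2 / 4" if "k \<ge> N" for k
      proof -
        have "inverse (real (Suc k)) \<le> inverse (real (Suc N))"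
          using that by (simp add: field_simps)
        with X[of k] N show ?thesis by (smt (verit))
      qed
      have "(norm (X m - X n))\<^sup>2 < e\<^sup>2"
        using par[of "X m" "X n"] *[OF that(1)] *[OF that(2)] by argo
      then show ?thesis unfolding dist_norm using e by (simp add: power2_less_imp_less)
    qed
    then show "\<exists>M. \<forall>m\<ge>M. \<forall>n\<ge>M. dist (X m) (X n) < e" by blast
  qed
  then obtain v where v: "X \<longlonglongrightarrow> v" by (auto simp: Cauchy_convergent_iff convergent_def)
  have "(\<lambda>n. J (X n)) \<longlonglongrightarrow> J v"
    unfolding J_def by (intro tendsto_intros v f.tendsto)
  moreover have "(\<lambda>n. d + inverse (Suc n)) \<longlonglongrightarrow> d + 0"
    by (intro tendsto_intros LIMSEQ_inverse_real_of_nat)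
  ultimately have "J v \<le> d + 0"
    by (rule LIMSEQ_le) (use X less_imp_le in blast)
  then have Jv: "J v \<le> J y" for y using dle[of y] by simp
  have Re: "Re (f y) = Re (cinner y v)" for y
  proof -
    define b where "b = Re (cinner v y) - Re (f y)"
    have q: "0 \<le> 2 * r * b + r\<^sup>2 * (norm y)\<^sup>2" for r
      using Jv[of "v + r *\<^sub>R y"]
      by (simp add: J_def norm_add_square cinner.scaleR_right f.add f.scaleR b_def
          power_mult_distrib algebra_simps)
    have "b = 0"
    proof (cases "y = 0")
      case False
      have "0 \<le> 2 * (- b / (norm y)\<^sup>2) * b + (- b / (norm y)\<^sup>2)\<^sup>2 * (norm y)\<^sup>2" by (rule q)
      also have "\<dots> = - (b\<^sup>2 / (norm y)\<^sup>2)" using False by (simp add: field_simps power2_eq_square)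
      finally have "b\<^sup>2 / (norm y)\<^sup>2 \<le> 0" by simp
      then show ?thesis using False by (simp add: divide_le_0_iff)
    qed (simp add: b_def cinner.zero_right f.zero)
    moreover have "Re (cinner v y) = Re (cinner y v)"
      by (metis cinner_commute complex_cnj(1) complex_eqI cnj.simps(1))
    ultimately show ?thesis by (simp add: b_def)
  qed
  have "f y = cinner y v" for y
  proof (rule complex_eqI)
    show "Re (f y) = Re (cinner y v)" by (rule Re)
    show "Im (f y) = Im (cinner y v)"
      using Re[of "\<i> *\<^sub>C y"] by (simp add: scale cinner_scaleC_left)
  qed
  then show ?thesis by (rule that)
qed

lemma bounded_opsD:
  assumes "a \<in> bounded_ops"
  shows "blinfun_apply a (c *\<^sub>C h) = c *\<^sub>C blinfun_apply a h"
  using assms by (simp add: bounded_ops_def)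

text \<open>Adjoints and slices are all obtained from their matrix coefficients through this lemma.\<close>
lemma sesquilinear_form_operator:
  fixes B :: "'h::complex_hilbert_space \<Rightarrow> 'h \<Rightarrow> complex"
  assumes "\<And>x x' y. B (x + x') y = B x y + B x' y" "\<And>c x y. B (c *\<^sub>C x) y = c * B x y"
    and "\<And>x y y'. B x (y + y') = B x y + B x y'" "\<And>c x y. B x (c *\<^sub>C y) = cnj c * B x y"
    and K: "K \<ge> 0" "\<And>x y. cmod (B x y) \<le> K * norm x * norm y"
  obtains a where "a \<in> bounded_ops" "\<And>x y. cinner (blinfun_apply a x) y = B x y" "norm a \<le> K"
proof -
  have "\<exists>v. \<forall>y. cnj (B x y) = cinner y v" for x
    by (rule Riesz_representation[of "\<lambda>y. cnj (B x y)" "K * norm x"]) (use assms in auto)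
  then obtain A where A: "\<And>x y. cnj (B x y) = cinner y (A x)" by metis
  have A': "cinner (A x) y = B x y" for x y
    by (metis A cinner_commute complex_cnj_cnj)
  have nA: "norm (A x) \<le> norm x * K" for x
  proof -
    have "norm (A x) * norm (A x) = cmod (cinner (A x) (A x))"
      unfolding cinner_self norm_of_real by (simp add: power2_eq_square)
    also have "\<dots> \<le> (norm x * K) * norm (A x)" unfolding A' using K(2)[of x "A x"] by (simp add: mult_ac)
    finally show ?thesis using K(1) by (cases "norm (A x) = 0") auto
  qed
  have blA: "bounded_linear A"
  proof (rule bounded_linear_intro[OF _ _ nA])
    show "A (x + y) = A x + A y" for x y
      by (rule cinner_left_ext) (simp add: A' assms cinner_add_left)
    show "A (r *\<^sub>R x) = r *\<^sub>R A x" for r x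
      by (rule cinner_left_ext) (simp add: A' assms cinner_scaleC_left scaleR_scaleC[where 'a='h])
  qed
  show ?thesis
  proof
    show "Blinfun A \<in> bounded_ops"
      unfolding bounded_ops_def mem_Collect_eq bounded_linear_Blinfun_apply[OF blA]
      by (intro allI, rule cinner_left_ext) (simp add: A' assms cinner_scaleC_left)
    show "cinner (blinfun_apply (Blinfun A) x) y = B x y" for x y
      using blA by (simp add: bounded_linear_Blinfun_apply A')
    show "norm (Blinfun A) \<le> K"
      using blA nA K(1) by (intro norm_blinfun_bound) (auto simp: bounded_linear_Blinfun_apply mult.commute)
  qed
qed

lemma cmod_cinner_apply_le:
  "cmod (cinner (blinfun_apply a x) y) \<le> norm a * norm x * norm (y::'b::complex_inner)"
  by (meson Cauchy_Schwarz mult_right_mono norm_blinfun norm_ge_zero order_trans)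

lemma norm_le_form_bound:
  fixes a :: "'h::real_normed_vector \<Rightarrow>\<^sub>L 'k::complex_inner"
  assumes "K \<ge> 0" "\<And>x y. cmod (cinner (blinfun_apply a x) y) \<le> K * norm x * norm y"
  shows "norm a \<le> K"
proof (rule norm_blinfun_bound[OF assms(1)])
  fix x
  have "norm (a x) * norm (a x) = cmod (cinner (a x) (a x))"
    unfolding cinner_self norm_of_real by (simp add: power2_eq_square)
  also have "\<dots> \<le> (K * norm x) * norm (a x)" by (rule assms(2))
  finally show "norm (a x) \<le> K * norm x" using assms(1) by (cases "norm (a x) = 0") auto
qed

lemma operator_form_ext:
  fixes a b :: "'a::real_normed_vector \<Rightarrow>\<^sub>L 'b::complex_inner"
  assumes "\<And>\<xi> \<eta>. cinner (blinfun_apply a \<xi>) \<eta> = cinner (blinfun_apply b \<xi>) \<eta>"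
  shows "a = b"
  using assms by (intro blinfun_eqI) (rule cinner_left_ext)

lemma cinner_adj:
  assumes "a \<in> bounded_ops"
  shows "cinner (blinfun_apply a x) y = cinner x (blinfun_apply (adj a) y)"
proof -
  have bnd: "cmod (cinner x (blinfun_apply a y)) \<le> norm a * norm x * norm y" for x y
    using cmod_cinner_apply_le[of a y x] cinner_commute[of x "blinfun_apply a y"] by (simp add: mult_ac)
  obtain b where b: "\<And>x y. cinner (blinfun_apply b x) y = cinner x (blinfun_apply a y)"
    by (rule sesquilinear_form_operator[of "\<lambda>x y. cinner x (blinfun_apply a y)" "norm a"])
      (use bnd in \<open>auto simp: cinner_add_left cinner_add_right cinner_scaleC_left cinner_scaleC_right
        blinfun.add_right bounded_opsD[OF assms]\<close>)
  have "\<forall>h k. cinner (blinfun_apply a h) k = cinner h (blinfun_apply b k)"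
    by (metis b cinner_commute)
  moreover have "c = b" if "\<forall>h k. cinner (blinfun_apply a h) k = cinner h (blinfun_apply c k)" for c
    
  proof (rule blinfun_eqI)
    show "blinfun_apply c k = blinfun_apply b k" for k
      by (rule cinner_right_ext) (metis that calculation)
  qed
  ultimately have "adj a = b" unfolding adj_def by (rule the_equality) 
  then show ?thesis by (metis b cinner_commute)
qed

lemma complex_subspaceD:
  assumes "complex_vector.subspace M"
  shows "0 \<in> M" "x \<in> M \<Longrightarrow> y \<in> M \<Longrightarrow> x + y \<in> M" "x \<in> M \<Longrightarrow> c *\<^sub>C x \<in> M"
  using assms by (auto simp: complex_vector.subspace_def)

lemma scaleC_minus_one: "(- 1) *\<^sub>C x = - (x::'a::complex_vector)"
  using complex_vector.scale_minus_left[of 1 x] by (simp add: scaleC_one)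

lemma complex_subspace_diff:
  assumes "complex_vector.subspace M" "x \<in> M" "y \<in> M"
  shows "x - y \<in> M"
  using assms complex_vector.subspace_diff by blast

lemma linear_on_add: "linear_on M T \<Longrightarrow> x \<in> M \<Longrightarrow> y \<in> M \<Longrightarrow> T (x + y) = T x + T y"
  by (simp add: linear_on_def)

lemma linear_on_scaleC: "linear_on M T \<Longrightarrow> x \<in> M \<Longrightarrow> T (c *\<^sub>C x) = c *\<^sub>C T x"
  by (simp add: linear_on_def)

lemma linear_on_diff:
  assumes "complex_vector.subspace M" "linear_on M T" "x \<in> M" "y \<in> M"
  shows "T (x - y) = T x - T y"
proof -
  have "T (x + (-1) *\<^sub>C y) = T x + (-1) *\<^sub>C T y"
    using assms by (metis complex_subspaceD(3) linear_on_add linear_on_scaleC)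
  then show ?thesis by (simp add: scaleC_minus_one)
qed

lemma subspace_bounded_ops: "complex_vector.subspace (bounded_ops :: ('h::complex_hilbert_space \<Rightarrow>\<^sub>L 'h) set)"
  by (auto simp: complex_vector.subspace_def bounded_ops_def blinfun.add_left scaleC_add_right
      scaleC_blinfun.rep_eq scaleC_scaleC mult.commute)

lemma id_in_bounded_ops: "id_blinfun \<in> bounded_ops"
  by (simp add: bounded_ops_def)

section \<open>Ultraweakly continuous functionals and maps\<close>

text \<open>The functionals generating the ultraweak topology, with a bound \<open>C\<close> for their nuclear norm. A common
  bound for both families of vectors loses nothing, since \<open>\<xi>\<close> and \<open>\<eta>\<close> can be rescaled against each
  other (\<open>nuclear_onI\<close>), and it makes the bound additive.\<close>
definition nuclear_on ::
    "('h::complex_hilbert_space \<Rightarrow>\<^sub>L 'h) set \<Rightarrow> real \<Rightarrow> (('h \<Rightarrow>\<^sub>L 'h) \<Rightarrow> complex) \<Rightarrow> bool"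
  where "nuclear_on A C f \<longleftrightarrow> (\<exists>\<xi> \<eta>.
    summable (\<lambda>n. (norm (\<xi> n))\<^sup>2) \<and> (\<Sum>n. (norm (\<xi> n))\<^sup>2) \<le> C \<and>
    summable (\<lambda>n. (norm (\<eta> n))\<^sup>2) \<and> (\<Sum>n. (norm (\<eta> n))\<^sup>2) \<le> C \<and>
    (\<forall>a\<in>A. f a = (\<Sum>n. cinner (blinfun_apply a (\<xi> n)) (\<eta> n))))"

lemma nuclear_on_cong:
  assumes "nuclear_on A C f" "\<And>a. a \<in> A \<Longrightarrow> f a = g a"
  shows "nuclear_on A C g"
  using assms unfolding nuclear_on_def by simp

lemma nuclear_onE:
  assumes "nuclear_on A C f"
  obtains \<xi> \<eta> where "summable (\<lambda>n. (norm (\<xi> n))\<^sup>2)" "(\<Sum>n. (norm (\<xi> n))\<^sup>2) \<le> C"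
    "summable (\<lambda>n. (norm (\<eta> n))\<^sup>2)" "(\<Sum>n. (norm (\<eta> n))\<^sup>2) \<le> C"
    "\<And>a. a \<in> A \<Longrightarrow> f a = (\<Sum>n. cinner (blinfun_apply a (\<xi> n)) (\<eta> n))"
  using assms unfolding nuclear_on_def by (elim exE conjE) (rule that, auto)

lemma nuclear_on_nonneg:
  assumes "nuclear_on A C f"
  shows "C \<ge> 0"
  using assms
proof (rule nuclear_onE)
  fix \<xi> :: "nat \<Rightarrow> 'a"
  assume "summable (\<lambda>n. (norm (\<xi> n))\<^sup>2)" "(\<Sum>n. (norm (\<xi> n))\<^sup>2) \<le> C"
  moreover have "0 \<le> (\<Sum>n. (norm (\<xi> n))\<^sup>2)" by (rule suminf_nonneg) (simp_all add: \<open>summable _\<close>)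
  ultimately show ?thesis by linarith
qed

lemma nuclear_on_mono:
  assumes "nuclear_on A C f" "C \<le> D"
  shows "nuclear_on A D f"
  using assms(1)
proof (rule nuclear_onE)
  fix \<xi> \<eta>
  assume *: "summable (\<lambda>n. (norm (\<xi> n))\<^sup>2)" "(\<Sum>n. (norm (\<xi> n))\<^sup>2) \<le> C"
    "summable (\<lambda>n. (norm (\<eta> n))\<^sup>2)" "(\<Sum>n. (norm (\<eta> n))\<^sup>2) \<le> C"
    "\<And>a. a \<in> A \<Longrightarrow> f a = (\<Sum>n. cinner (blinfun_apply a (\<xi> n)) (\<eta> n))"
  show ?thesis unfolding nuclear_on_def
    by (intro exI[of _ \<xi>] exI[of _ \<eta>] conjI ballI * order_trans[OF *(2) assms(2)] order_trans[OF *(4) assms(2)])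
qed

lemma cinner_series_bound:
  fixes \<xi> \<eta> :: "nat \<Rightarrow> 'h::complex_hilbert_space"
  assumes "summable (\<lambda>n. (norm (\<xi> n))\<^sup>2)" "(\<Sum>n. (norm (\<xi> n))\<^sup>2) \<le> C"
    and "summable (\<lambda>n. (norm (\<eta> n))\<^sup>2)" "(\<Sum>n. (norm (\<eta> n))\<^sup>2) \<le> C"
  shows "summable (\<lambda>n. cmod (cinner (blinfun_apply a (\<xi> n)) (\<eta> n)))"
    and "(\<Sum>n. cmod (cinner (blinfun_apply a (\<xi> n)) (\<eta> n))) \<le> C * norm a"
proof -
  let ?b = "\<lambda>n. norm a / 2 * ((norm (\<xi> n))\<^sup>2 + (norm (\<eta> n))\<^sup>2)"
  have le: "cmod (cinner (blinfun_apply a (\<xi> n)) (\<eta> n)) \<le> ?b n" for n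
  proof -
    have "norm (\<xi> n) * norm (\<eta> n) \<le> ((norm (\<xi> n))\<^sup>2 + (norm (\<eta> n))\<^sup>2) / 2"
      using sum_squares_bound[of "norm (\<xi> n)" "norm (\<eta> n)"] by simp
    then show ?thesis
      using cmod_cinner_apply_le[of a "\<xi> n" "\<eta> n"]
        mult_left_mono[of "norm (\<xi> n) * norm (\<eta> n)" _ "norm a"] by (fastforce simp: mult.assoc)
  qed
  have sb: "summable ?b" using assms by (intro summable_mult summable_add)
  show s: "summable (\<lambda>n. cmod (cinner (blinfun_apply a (\<xi> n)) (\<eta> n)))"
    by (rule summable_comparison_test'[OF sb, of 0]) (use le in simp)
  have "(\<Sum>n. cmod (cinner (blinfun_apply a (\<xi> n)) (\<eta> n))) \<le> (\<Sum>n. ?b n)"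
    by (rule suminf_le[OF le s sb])
  also have "\<dots> = norm a / 2 * ((\<Sum>n. (norm (\<xi> n))\<^sup>2) + (\<Sum>n. (norm (\<eta> n))\<^sup>2))"
    using assms by (simp only: suminf_mult suminf_add summable_add)
  also have "\<dots> \<le> norm a / 2 * (C + C)" using assms by (intro mult_left_mono add_mono) auto
  finally show "(\<Sum>n. cmod (cinner (blinfun_apply a (\<xi> n)) (\<eta> n))) \<le> C * norm a" by (simp add: mult.commute)
qed

lemma nuclear_on_bound:
  assumes "nuclear_on A C f" "a \<in> A"
  shows "cmod (f a) \<le> C * norm a"
proof -
  obtain \<xi> \<eta> where *: "summable (\<lambda>n. (norm (\<xi> n))\<^sup>2)" "(\<Sum>n. (norm (\<xi> n))\<^sup>2) \<le> C"
    "summable (\<lambda>n. (norm (\<eta> n))\<^sup>2)" "(\<Sum>n. (norm (\<eta> n))\<^sup>2) \<le> C"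
    and f: "f a = (\<Sum>n. cinner (blinfun_apply a (\<xi> n)) (\<eta> n))"
    by (rule nuclear_onE[OF assms(1)]) (use assms(2) in auto)
  show ?thesis unfolding f
    using summable_norm[OF cinner_series_bound(1)[OF *]] cinner_series_bound(2)[OF *] by (rule order_trans)
qed

lemma nuclear_onI:
  assumes "summable (\<lambda>n. (norm (\<xi> n))\<^sup>2)" "(\<Sum>n. (norm (\<xi> n))\<^sup>2) \<le> a\<^sup>2" "a \<ge> 0"
    and "summable (\<lambda>n. (norm (\<eta> n))\<^sup>2)" "(\<Sum>n. (norm (\<eta> n))\<^sup>2) \<le> b\<^sup>2" "b \<ge> 0"
    and f: "\<And>x. x \<in> A \<Longrightarrow> f x = (\<Sum>n. cinner (blinfun_apply x (\<xi> n)) (\<eta> n))"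
  shows "nuclear_on A (a * b) f"
proof (cases "a = 0 \<or> b = 0")
  case True
  have "\<xi> n = 0 \<or> \<eta> n = 0" for n
    using True
  proof
    assume "a = 0"
    then have "(\<Sum>n. (norm (\<xi> n))\<^sup>2) = 0" using assms suminf_nonneg[OF assms(1)] by simp
    then show ?thesis using suminf_eq_zero_iff[OF assms(1)] by simp
  next
    assume "b = 0"
    then have "(\<Sum>n. (norm (\<eta> n))\<^sup>2) = 0" using assms suminf_nonneg[OF assms(4)] by simp
    then show ?thesis using suminf_eq_zero_iff[OF assms(4)] by simp
  qed
  then have "cinner (blinfun_apply x (\<xi> n)) (\<eta> n) = 0" for x n
    by (metis blinfun.zero_right cinner.zero_left cinner.zero_right)
  then show ?thesis using True f
    unfolding nuclear_on_def by (intro exI[of _ "\<lambda>_. 0"]) (auto simp: cinner.zero_right)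
next
  case False
  then have ab: "a > 0" "b > 0" using assms by auto
  let ?c = "sqrt (b / a)" let ?d = "sqrt (a / b)"
  have cd: "?c * ?d = 1" using ab by (simp flip: real_sqrt_mult)
  have n1: "(norm (?c *\<^sub>R \<xi> n))\<^sup>2 = b / a * (norm (\<xi> n))\<^sup>2" for n
    using ab by (simp add: power_mult_distrib)
  have n2: "(norm (?d *\<^sub>R \<eta> n))\<^sup>2 = a / b * (norm (\<eta> n))\<^sup>2" for n
    using ab by (simp add: power_mult_distrib)
  have p: "cinner (blinfun_apply x (?c *\<^sub>R \<xi> n)) (?d *\<^sub>R \<eta> n) = cinner (blinfun_apply x (\<xi> n)) (\<eta> n)" for x n
    using cd by (simp add: blinfun.scaleR_right cinner_scaleR_left cinner_scaleR_right mult.commute)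
  have "b / a * (\<Sum>n. (norm (\<xi> n))\<^sup>2) \<le> b / a * a\<^sup>2" "a / b * (\<Sum>n. (norm (\<eta> n))\<^sup>2) \<le> a / b * b\<^sup>2"
    using assms ab by (intro mult_left_mono; simp)+
  then have "b / a * (\<Sum>n. (norm (\<xi> n))\<^sup>2) \<le> a * b" "a / b * (\<Sum>n. (norm (\<eta> n))\<^sup>2) \<le> a * b"
    using ab by (simp_all add: power2_eq_square mult.commute)
  then show ?thesis unfolding nuclear_on_def
    by (intro exI[of _ "\<lambda>n. ?c *\<^sub>R \<xi> n"] exI[of _ "\<lambda>n. ?d *\<^sub>R \<eta> n"],
        unfold n1 n2 p suminf_mult[OF assms(1)] suminf_mult[OF assms(4)])
      (intro conjI ballI summable_mult assms(1,4) f)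
qed

lemma nuclear_on_finite_sum:
  assumes "finite I"
  shows "nuclear_on A (sqrt (\<Sum>i\<in>I. (norm (\<xi> i))\<^sup>2) * sqrt (\<Sum>i\<in>I. (norm (\<eta> i))\<^sup>2))
    (\<lambda>a. \<Sum>i\<in>I. cinner (blinfun_apply a (\<xi> i)) (\<eta> (i::nat)))"
proof (rule nuclear_onI)
  let ?x = "\<lambda>\<xi> i. if i \<in> I then \<xi> i else 0"
  have s: "(\<lambda>n. (norm (?x \<zeta> n))\<^sup>2) sums (\<Sum>i\<in>I. (norm (\<zeta> i))\<^sup>2)" for \<zeta> :: "nat \<Rightarrow> 'a"
  proof -
    have "(\<lambda>n. if n \<in> I then (norm (\<zeta> n))\<^sup>2 else 0) sums (\<Sum>i\<in>I. (norm (\<zeta> i))\<^sup>2)"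
      by (rule sums_If_finite_set[OF assms])
    moreover have "(\<lambda>n. if n \<in> I then (norm (\<zeta> n))\<^sup>2 else 0) = (\<lambda>n. (norm (?x \<zeta> n))\<^sup>2)" by auto
    ultimately show ?thesis by simp
  qed
  show "summable (\<lambda>n. (norm (?x \<xi> n))\<^sup>2)" "summable (\<lambda>n. (norm (?x \<eta> n))\<^sup>2)"
    using s[THEN sums_summable] by auto
  show "(\<Sum>n. (norm (?x \<xi> n))\<^sup>2) \<le> (sqrt (\<Sum>i\<in>I. (norm (\<xi> i))\<^sup>2))\<^sup>2"
    "(\<Sum>n. (norm (?x \<eta> n))\<^sup>2) \<le> (sqrt (\<Sum>i\<in>I. (norm (\<eta> i))\<^sup>2))\<^sup>2"
    unfolding s[THEN sums_unique, symmetric] by (simp_all add: sum_nonneg)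
  fix a
  have "(\<lambda>n. if n \<in> I then cinner (blinfun_apply a (\<xi> n)) (\<eta> n) else 0) sums
    (\<Sum>i\<in>I. cinner (blinfun_apply a (\<xi> i)) (\<eta> i))"
    by (rule sums_If_finite_set[OF assms])
  moreover have "(\<lambda>n. if n \<in> I then cinner (blinfun_apply a (\<xi> n)) (\<eta> n) else 0) =
    (\<lambda>n. cinner (blinfun_apply a (?x \<xi> n)) (?x \<eta> n))" by (auto simp: cinner.zero_right)
  ultimately show "(\<Sum>i\<in>I. cinner (blinfun_apply a (\<xi> i)) (\<eta> i)) =
    (\<Sum>n. cinner (blinfun_apply a (?x \<xi> n)) (?x \<eta> n))"
    by (simp add: sums_iff)
qed (auto simp: sum_nonneg)

lemma nuclear_on_vector: "nuclear_on A (norm \<xi> * norm \<eta>) (\<lambda>a. cinner (blinfun_apply a \<xi>) \<eta>)"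
  using nuclear_on_finite_sum[of "{0}" A "\<lambda>_. \<xi>" "\<lambda>_. \<eta>"] by simp

lemma nuclear_on_scale:
  assumes "nuclear_on A C f"
  shows "nuclear_on A (cmod c * C) (\<lambda>a. c * f a)"
proof -
  obtain \<xi> \<eta> where *: "summable (\<lambda>n. (norm (\<xi> n))\<^sup>2)" "(\<Sum>n. (norm (\<xi> n))\<^sup>2) \<le> C"
    "summable (\<lambda>n. (norm (\<eta> n))\<^sup>2)" "(\<Sum>n. (norm (\<eta> n))\<^sup>2) \<le> C"
    and f: "\<And>a. a \<in> A \<Longrightarrow> f a = (\<Sum>n. cinner (blinfun_apply a (\<xi> n)) (\<eta> n))"
    by (rule nuclear_onE[OF assms]) (rule that)
  have C: "C \<ge> 0" by (rule nuclear_on_nonneg[OF assms])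
  have n: "(norm (cnj c *\<^sub>C \<eta> n))\<^sup>2 = (cmod c)\<^sup>2 * (norm (\<eta> n))\<^sup>2" for n
    by (simp add: norm_scaleC power_mult_distrib)
  have "nuclear_on A (sqrt C * (cmod c * sqrt C)) (\<lambda>a. c * f a)"
  proof (rule nuclear_onI[where \<xi>=\<xi> and \<eta>="\<lambda>n. cnj c *\<^sub>C \<eta> n"])
    show "summable (\<lambda>n. (norm (cnj c *\<^sub>C \<eta> n))\<^sup>2)"
      unfolding n using *(3) by (rule summable_mult)
    show "(\<Sum>n. (norm (cnj c *\<^sub>C \<eta> n))\<^sup>2) \<le> (cmod c * sqrt C)\<^sup>2"
      unfolding n suminf_mult[OF *(3)] using *(4) C by (simp add: power_mult_distrib mult_left_mono)
    show "c * f a = (\<Sum>n. cinner (blinfun_apply a (\<xi> n)) (cnj c *\<^sub>C \<eta> n))" if "a \<in> A" for a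
      unfolding f[OF that] cinner_scaleC_right complex_cnj_cnj
      by (rule suminf_mult[symmetric], rule summable_norm_cancel, rule cinner_series_bound(1)[OF *])
  qed (use * C in auto)
  moreover have "sqrt C * (cmod c * sqrt C) = cmod c * C"
    using C by (metis mult.assoc mult.commute real_sqrt_mult_self abs_of_nonneg)
  ultimately show ?thesis by simp
qed

lemma nonneg_double_series:
  fixes p :: "nat \<Rightarrow> nat \<Rightarrow> real"
  assumes nn: "\<And>n m. p n m \<ge> 0" and row: "\<And>n. summable (p n)" "\<And>n. suminf (p n) \<le> C n"
    and C: "summable C"
  shows "summable (\<lambda>k. case_prod p (prod_decode k))"
    and "(\<Sum>k. case_prod p (prod_decode k)) \<le> suminf C"
proof -
  have r: "(p n has_sum suminf (p n)) UNIV" for n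
    using norm_summable_imp_has_sum[of "p n" "suminf (p n)"] row(1) nn by (simp add: summable_sums)
  have s: "summable (\<lambda>n. suminf (p n))"
    by (rule summable_comparison_test'[OF C, of 0]) (use row nn in \<open>simp add: suminf_nonneg\<close>)
  have g: "((\<lambda>n. suminf (p n)) has_sum (\<Sum>n. suminf (p n))) UNIV"
    using s row nn by (intro norm_summable_imp_has_sum) (simp_all add: suminf_nonneg summable_sums)
  have "case_prod p summable_on (UNIV \<times> UNIV)"
    by (rule summable_on_SigmaI[where g="\<lambda>n. suminf (p n)"])
      (use r nn g in \<open>auto intro: has_sum_imp_summable\<close>)
  then have "(case_prod p has_sum (\<Sum>n. suminf (p n))) (UNIV \<times> UNIV)"
    by (intro has_sum_SigmaI[where g="\<lambda>n. suminf (p n)"]) (use r g in auto)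
  then have "((\<lambda>k. case_prod p (prod_decode k)) has_sum (\<Sum>n. suminf (p n))) UNIV"
    using has_sum_reindex_bij_betw[of prod_decode UNIV UNIV "case_prod p"] bij_prod_decode by simp
  then have t: "(\<lambda>k. case_prod p (prod_decode k)) sums (\<Sum>n. suminf (p n))"
    by (rule has_sum_imp_sums)
  show "summable (\<lambda>k. case_prod p (prod_decode k))" using t by (rule sums_summable)
  show "(\<Sum>k. case_prod p (prod_decode k)) \<le> suminf C"
    using t suminf_le[OF row(2) s C] by (simp add: sums_iff)
qed

lemma absolute_double_series:
  fixes p :: "nat \<Rightarrow> nat \<Rightarrow> complex"
  assumes row: "\<And>n. summable (\<lambda>m. cmod (p n m))" "\<And>n. (\<Sum>m. cmod (p n m)) \<le> C n"
    and C: "summable C"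
  shows "(\<Sum>k. case_prod p (prod_decode k)) = (\<Sum>n. \<Sum>m. p n m)"
proof -
  have "summable (\<lambda>k. case_prod (\<lambda>n m. cmod (p n m)) (prod_decode k))"
    by (rule nonneg_double_series(1)[where C=C]) (simp_all add: row C)
  then have s: "summable (\<lambda>k. cmod (case_prod p (prod_decode k)))"
    by (simp add: case_prod_unfold)
  have "((\<lambda>k. case_prod p (prod_decode k)) has_sum (\<Sum>k. case_prod p (prod_decode k))) UNIV"
    using s by (intro norm_summable_imp_has_sum) (auto intro: summable_sums summable_norm_cancel)
  then have a: "(case_prod p has_sum (\<Sum>k. case_prod p (prod_decode k))) (UNIV \<times> UNIV)"
    using has_sum_reindex_bij_betw[of prod_decode UNIV UNIV "case_prod p"] bij_prod_decode by simp
  have b: "(p n has_sum suminf (p n)) UNIV" for n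
    using row(1)[of n] by (intro norm_summable_imp_has_sum) (auto intro: summable_sums summable_norm_cancel)
  have "((\<lambda>n. suminf (p n)) has_sum (\<Sum>k. case_prod p (prod_decode k))) UNIV"
    by (rule has_sum_SigmaD[OF a]) (simp add: b)
  then show ?thesis by (rule has_sum_imp_sums[THEN sums_unique])
qed

text \<open>The two double families of vectors are rearranged into single sequences; the bounds add up to
  square summability of these.\<close>
lemma nuclear_on_suminf:
  assumes N: "\<And>n. nuclear_on A (C n) (g n)" and C: "summable C"
  shows "nuclear_on A (suminf C) (\<lambda>a. \<Sum>n. g n a)"
proof -
  have "\<forall>n. nuclear_on A (C n) (g n)" using N by simp
  then obtain \<xi> \<eta> where "\<forall>n. summable (\<lambda>m. (norm (\<xi> n m))\<^sup>2) \<and> (\<Sum>m. (norm (\<xi> n m))\<^sup>2) \<le> C n \<and>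
    summable (\<lambda>m. (norm (\<eta> n m))\<^sup>2) \<and> (\<Sum>m. (norm (\<eta> n m))\<^sup>2) \<le> C n \<and>
    (\<forall>a\<in>A. g n a = (\<Sum>m. cinner (blinfun_apply a (\<xi> n m)) (\<eta> n m)))"
    unfolding nuclear_on_def choice_iff by (elim exE) (rule that)
  then have
    *: "\<And>n. summable (\<lambda>m. (norm (\<xi> n m))\<^sup>2)" "\<And>n. (\<Sum>m. (norm (\<xi> n m))\<^sup>2) \<le> C n"
    "\<And>n. summable (\<lambda>m. (norm (\<eta> n m))\<^sup>2)" "\<And>n. (\<Sum>m. (norm (\<eta> n m))\<^sup>2) \<le> C n"
    and g: "\<And>n a. a \<in> A \<Longrightarrow> g n a = (\<Sum>m. cinner (blinfun_apply a (\<xi> n m)) (\<eta> n m))"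
    by auto
  have series: "summable (\<lambda>k. (norm (case_prod \<zeta> (prod_decode k)))\<^sup>2)"
    "(\<Sum>k. (norm (case_prod \<zeta> (prod_decode k)))\<^sup>2) \<le> suminf C"
    if "\<And>n. summable (\<lambda>m. (norm (\<zeta> n m))\<^sup>2)" "\<And>n. (\<Sum>m. (norm (\<zeta> n m))\<^sup>2) \<le> C n"
    for \<zeta> :: "nat \<Rightarrow> nat \<Rightarrow> 'a"
    using nonneg_double_series[of "\<lambda>n m. (norm (\<zeta> n m))\<^sup>2", OF _ that C]
    by (simp_all add: case_prod_unfold)
  have "(\<Sum>n. g n a) = (\<Sum>k. cinner (blinfun_apply a (case_prod \<xi> (prod_decode k))) (case_prod \<eta> (prod_decode k)))"
    if "a \<in> A" for a
    using absolute_double_series[of "\<lambda>n m. cinner (blinfun_apply a (\<xi> n m)) (\<eta> n m)" "\<lambda>n. C n * norm a"]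
      cinner_series_bound[OF *] C
    by (simp add: g that case_prod_unfold summable_mult2)
  then show ?thesis unfolding nuclear_on_def
    by (intro exI[of _ "\<lambda>k. case_prod \<xi> (prod_decode k)"] exI[of _ "\<lambda>k. case_prod \<eta> (prod_decode k)"]
        conjI ballI series[OF *(1,2)] series[OF *(3,4)])
qed

lemma nuclear_on_zero: "nuclear_on A 0 (\<lambda>_. 0)"
  using nuclear_on_vector[of A 0 0] by (simp add: cinner.zero_right)

lemma nuclear_on_add:
  assumes "nuclear_on A C f" "nuclear_on A D g"
  shows "nuclear_on A (C + D) (\<lambda>a. f a + g a)"
proof -
  let ?g = "\<lambda>n::nat. if n = 0 then f else if n = 1 then g else (\<lambda>_. 0)"
  let ?C = "\<lambda>n::nat. if n = 0 then C else if n = 1 then D else 0"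
  have C: "?C sums (C + D)" using sums_finite[of "{0,1}" ?C] by simp
  have "(\<lambda>n. ?g n a) sums (f a + g a)" for a
    using sums_finite[of "{0,1}" "\<lambda>n. ?g n a"] by simp
  moreover have "nuclear_on A (suminf ?C) (\<lambda>a. \<Sum>n. ?g n a)"
    by (rule nuclear_on_suminf) (use assms C nuclear_on_zero in \<open>auto simp: sums_iff\<close>)
  ultimately show ?thesis using C by (simp add: sums_iff)
qed

lemma nuclear_on_sum:
  assumes "finite F" "\<And>i. i \<in> F \<Longrightarrow> nuclear_on A (C i) (f i)"
  shows "nuclear_on A (\<Sum>i\<in>F. C i) (\<lambda>a. \<Sum>i\<in>F. f i a)"
  using assms by (induction F) (auto intro: nuclear_on_zero nuclear_on_add)

lemma topspace_initial_topology:
  assumes "F \<noteq> {}"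
  shows "topspace (initial_topology F) = UNIV"
proof -
  obtain f where "f \<in> F" using assms by blast
  then have "f -` UNIV \<in> {f -` U | f U. f \<in> F \<and> open U}" by (intro CollectI exI conjI) auto
  then have "f -` UNIV \<subseteq> \<Union> {f -` U | f U. f \<in> F \<and> open U}" by (rule Union_upper)
  then show ?thesis unfolding initial_topology_def topology_generated_by_topspace
    by (simp add: top.extremum_uniqueI)
qed

lemma continuous_map_initial_topology:
  assumes "f \<in> F"
  shows "continuous_map (initial_topology F) euclidean f"
proof (rule continuous_map_openin_preimage_eq[THEN iffD2], intro conjI allI impI)
  fix U :: "complex set" assume "openin euclidean U"
  then have "openin (initial_topology F) (f -` U)"
    unfolding initial_topology_def using assms by (intro topology_generated_by_Basis) auto
  then show "openin (initial_topology F) (topspace (initial_topology F) \<inter> f -` U)"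
    by (simp add: openin_Int)
qed auto

abbreviation vector_functionals :: "(('h::complex_hilbert_space \<Rightarrow>\<^sub>L 'h) \<Rightarrow> complex) set"
  where "vector_functionals \<equiv> {(\<lambda>x. cinner (blinfun_apply x \<xi>) \<eta>) | \<xi> \<eta>. True}"

abbreviation nuclear_functionals :: "(('h::complex_hilbert_space \<Rightarrow>\<^sub>L 'h) \<Rightarrow> complex) set"
  where "nuclear_functionals \<equiv> {(\<lambda>x. \<Sum>n. cinner (blinfun_apply x (\<xi> n)) (\<eta> n)) | \<xi> \<eta> :: nat \<Rightarrow> 'h.
          summable (\<lambda>n. (norm (\<xi> n))\<^sup>2) \<and> summable (\<lambda>n. (norm (\<eta> n))\<^sup>2)}"

lemma nuclear_functionals_nonempty: "nuclear_functionals \<noteq> {}"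
  by (rule ex_in_conv[THEN iffD1], rule exI, rule CollectI,
      intro exI[of _ "\<lambda>_. 0"] conjI, rule refl) simp_all

lemma topspace_ultraweak: "topspace ultraweak_topology = bounded_ops"
  unfolding ultraweak_topology_def
  by (simp add: topspace_initial_topology[OF nuclear_functionals_nonempty])

lemma nuclear_on_continuous:
  assumes "nuclear_on A C f"
  shows "continuous_map (subtopology ultraweak_topology A) euclidean f"
proof -
  obtain g where g: "g \<in> nuclear_functionals" "\<And>a. a \<in> A \<Longrightarrow> f a = g a"
    using assms unfolding nuclear_on_def by blast
  have "continuous_map (subtopology ultraweak_topology A) euclidean g"
    unfolding ultraweak_topology_def
    by (intro continuous_map_from_subtopology continuous_map_initial_topology g)
  then show ?thesis by (rule continuous_map_eq) (use g(2) in auto)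
qed

lemma nuclear_functional_nuclear_on:
  assumes "f \<in> nuclear_functionals"
  shows "\<exists>C. nuclear_on A C f"
proof -
  obtain \<xi> \<eta> where *: "summable (\<lambda>n. (norm (\<xi> n))\<^sup>2)" "summable (\<lambda>n. (norm (\<eta> n))\<^sup>2)"
    "f = (\<lambda>x. \<Sum>n. cinner (blinfun_apply x (\<xi> n)) (\<eta> n))" using assms by blast
  then have "nuclear_on A (max (\<Sum>n. (norm (\<xi> n))\<^sup>2) (\<Sum>n. (norm (\<eta> n))\<^sup>2)) f"
    unfolding nuclear_on_def by (intro exI[of _ \<xi>] exI[of _ \<eta>]) auto
  then show ?thesis ..
qed

lemma continuous_map_into_initial_topology:
  assumes "F \<noteq> {}" "\<And>f. f \<in> F \<Longrightarrow> continuous_map X euclidean (\<lambda>x. f (T x))"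
  shows "continuous_map X (initial_topology F) T"
  unfolding initial_topology_def
proof (rule continuous_on_generated_topo)
  fix U assume "U \<in> {f -` V | f V. f \<in> F \<and> open V}"
  then obtain f V where U: "U = f -` V" "f \<in> F" "open V" by blast
  then have "openin X {x \<in> topspace X. f (T x) \<in> V}"
    using assms(2) by (intro openin_continuous_map_preimage) auto
  moreover have "{x \<in> topspace X. f (T x) \<in> V} = T -` U \<inter> topspace X" using U by auto
  ultimately show "openin X (T -` U \<inter> topspace X)" by simp
qed (use topspace_initial_topology[OF assms(1)] in \<open>simp add: initial_topology_def\<close>)

text \<open>Ultraweak continuity only has to be tested on vector functionals, provided that the nuclear
  bound is uniform: a generator \<open>\<Sum>n. \<langle>\<cdot> \<xi>\<^sub>n, \<eta>\<^sub>n\<rangle>\<close> then pulls back to an absolutely convergent sum.\<close>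
lemma normal_mapI:
  assumes T: "T \<in> A \<rightarrow> B" and B: "B \<subseteq> bounded_ops" and lin: "linear_on A T"
    and N: "\<And>\<xi> \<eta>. nuclear_on A (K * norm \<xi> * norm \<eta>) (\<lambda>a. cinner (blinfun_apply (T a) \<xi>) \<eta>)"
  shows "normal_map A B T"
proof -
  have "continuous_map (subtopology ultraweak_topology A) euclidean (\<lambda>a. f (T a))"
    if f: "f \<in> nuclear_functionals" for f
  proof -
    obtain \<xi> \<eta> :: "nat \<Rightarrow> 'b" where *: "summable (\<lambda>n. (norm (\<xi> n))\<^sup>2)" "summable (\<lambda>n. (norm (\<eta> n))\<^sup>2)"
      "f = (\<lambda>x. \<Sum>n. cinner (blinfun_apply x (\<xi> n)) (\<eta> n))" using f by blast
    have "summable (\<lambda>n. norm (\<xi> n) * norm (\<eta> n))"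
    proof (rule summable_comparison_test'[of _ 0])
      show "summable (\<lambda>n. ((norm (\<xi> n))\<^sup>2 + (norm (\<eta> n))\<^sup>2) / 2)"
        using * by (intro summable_divide summable_add)
      show "norm (norm (\<xi> n) * norm (\<eta> n)) \<le> ((norm (\<xi> n))\<^sup>2 + (norm (\<eta> n))\<^sup>2) / 2" for n
        using sum_squares_bound[of "norm (\<xi> n)" "norm (\<eta> n)"] by simp
    qed
    then have "summable (\<lambda>n. K * norm (\<xi> n) * norm (\<eta> n))" by (simp add: summable_mult mult.assoc)
    with N have "nuclear_on A (\<Sum>n. K * norm (\<xi> n) * norm (\<eta> n)) (\<lambda>a. f (T a))"
      unfolding *(3) by (rule nuclear_on_suminf)
    then show ?thesis by (rule nuclear_on_continuous)
  qed
  then have "continuous_map (subtopology ultraweak_topology A) (initial_topology nuclear_functionals) T"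
    by (intro continuous_map_into_initial_topology nuclear_functionals_nonempty)
  moreover have "T ` topspace (subtopology ultraweak_topology A) \<subseteq> bounded_ops \<inter> B"
    using T B by (auto simp: Pi_iff)
  ultimately have "continuous_map (subtopology ultraweak_topology A) (subtopology ultraweak_topology B) T"
    unfolding ultraweak_topology_def subtopology_subtopology continuous_map_in_subtopology
    by (auto simp: image_subset_iff)
  then show ?thesis unfolding normal_map_def using T lin by blast
qed

lemma normal_functionalI:
  assumes "linear_on A f" "nuclear_on A C f"
  shows "normal_functional A f"
  using assms unfolding normal_functional_def by (auto intro: nuclear_on_continuous)

lemma normal_functional_comp:
  assumes "normal_map A B T" "normal_functional B f"
  shows "normal_functional A (\<lambda>a. f (T a))"
proof -
  have T: "T \<in> A \<rightarrow> B" and l: "linear_on A T" "linear_on B f" using assms by (auto simp: normal_map_def normal_functional_def)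
  have "linear_on A (\<lambda>a. f (T a))"
    using T l unfolding linear_on_def by (auto simp: Pi_iff)
  moreover have "continuous_map (subtopology ultraweak_topology A) euclidean (f \<circ> T)"
    using assms unfolding normal_map_def normal_functional_def by (auto intro: continuous_map_compose)
  ultimately show ?thesis by (simp add: normal_functional_def o_def)
qed

lemma open_in_initial_topology_nbhd:
  assumes "openin (initial_topology F) U" "x \<in> U"
  shows "\<exists>G e. finite G \<and> G \<subseteq> F \<and> e > 0 \<and> (\<forall>y. (\<forall>f\<in>G. cmod (f y - f x) < e) \<longrightarrow> y \<in> U)"
proof -
  have "generate_topology_on {f -` V | f V. f \<in> F \<and> open V} U"
    using assms by (simp add: initial_topology_def openin_topology_generated_by_iff)
  then show ?thesis using assms(2)
  proof (induction arbitrary: x rule: generate_topology_on.induct)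
    case Empty then show ?case by simp
  next
    case (Int a b)
    then have x: "x \<in> a" "x \<in> b" by auto
    obtain G e where a: "finite G" "G \<subseteq> F" "e > 0" "\<forall>y. (\<forall>f\<in>G. cmod (f y - f x) < e) \<longrightarrow> y \<in> a"
      using Int.IH(1)[OF x(1)] by metis
    obtain G' e' where b: "finite G'" "G' \<subseteq> F" "e' > 0" "\<forall>y. (\<forall>f\<in>G'. cmod (f y - f x) < e') \<longrightarrow> y \<in> b"
      using Int.IH(2)[OF x(2)] by metis
    show ?case
      using a b by (intro exI[of _ "G \<union> G'"] exI[of _ "min e e'"]) auto
  next
    case (UN K)
    then show ?case by (meson UnionE UnionI)
  next
    case (Basis s)
    then obtain f V where s: "s = f -` V" "f \<in> F" "open V" by blast
    then obtain e where "e > 0" "\<forall>z. dist z (f x) < e \<longrightarrow> z \<in> V"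
      using Basis.prems by (metis open_dist vimageD)
    then show ?case using s by (intro exI[of _ "{f}"] exI[of _ e]) (auto simp: dist_norm)
  qed
qed

text \<open>Induction on \<open>G\<close>, passing to the kernel of one functional \<open>h\<close>: the combination found there differs
  from \<open>f\<close> by a functional vanishing on the kernel of \<open>h\<close>, that is, by a multiple of \<open>h\<close>.\<close>
lemma linear_combination_of_kernel_inclusion:
  assumes "finite G" "complex_vector.subspace M" "linear_on M f" "\<And>g. g \<in> G \<Longrightarrow> linear_on M g"
    and "\<And>x. x \<in> M \<Longrightarrow> (\<forall>g\<in>G. g x = 0) \<Longrightarrow> f x = (0::complex)"
  shows "\<exists>c. \<forall>x\<in>M. f x = (\<Sum>g\<in>G. c g * g x)"
  using assms
proof (induction G arbitrary: M rule: finite_induct)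
  case empty
  then show ?case by simp
next
  case (insert h G)
  let ?M = "{x \<in> M. h x = 0}"
  have lh: "linear_on M h" using insert by simp
  have h0: "h 0 = 0"
    using linear_on_scaleC[OF lh, of 0 0] complex_subspaceD(1)[OF insert.prems(1)] by (simp add: scaleC_complex_def)
  have sub: "complex_vector.subspace ?M"
    using insert.prems(1) lh h0 unfolding complex_vector.subspace_def linear_on_def
    by (auto simp: scaleC_complex_def)
  have res: "linear_on M u \<Longrightarrow> linear_on ?M u" for u :: "'a \<Rightarrow> complex"
    by (simp add: linear_on_def)
  have "\<exists>c. \<forall>x\<in>?M. f x = (\<Sum>g\<in>G. c g * g x)"
    using insert.prems by (intro insert.IH sub res) auto
  then obtain c where c: "\<And>x. x \<in> M \<Longrightarrow> h x = 0 \<Longrightarrow> f x = (\<Sum>g\<in>G. c g * g x)" by blast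
  define f' where "f' x = f x - (\<Sum>g\<in>G. c g * g x)" for x
  have f'diff: "f' (x - a *\<^sub>C y) = f' x - a * f' y" if "x \<in> M" "y \<in> M" for x y a
  proof -
    have *: "u (x - a *\<^sub>C y) = u x - a * u y" if "linear_on M u" for u :: "'a \<Rightarrow> complex"
      using linear_on_diff[OF insert.prems(1) that \<open>x \<in> M\<close> complex_subspaceD(3)[OF insert.prems(1) \<open>y \<in> M\<close>], of a]
        linear_on_scaleC[OF that \<open>y \<in> M\<close>, of a] by (simp add: scaleC_complex_def)
    show ?thesis unfolding f'_def using insert.prems
      by (simp add: * sum_subtractf sum_distrib_left algebra_simps)
  qed
  have "\<exists>a. \<forall>x\<in>M. f' x = a * h x"
  proof (cases "\<forall>x\<in>M. h x = 0")
    case True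
    then show ?thesis using c by (auto simp: f'_def)
  next
    case False
    then obtain y where y: "y \<in> M" "h y \<noteq> 0" by blast
    have "f' x = f' y / h y * h x" if x: "x \<in> M" for x
    proof -
      let ?z = "x - (h x / h y) *\<^sub>C y"
      have zM: "?z \<in> M" using x y insert.prems(1) complex_subspace_diff complex_subspaceD(3) by blast
      have "h ?z = h x - h x / h y * h y"
        using linear_on_diff[OF insert.prems(1) lh x complex_subspaceD(3)[OF insert.prems(1) y(1)]]
          linear_on_scaleC[OF lh y(1)] by (simp add: scaleC_complex_def)
      then have "f' ?z = 0" using c[OF zM] y by (simp add: f'_def)
      then show ?thesis using f'diff[OF x y(1), of "h x / h y"] by simp
    qed
    then show ?thesis by blast
  qed
  then obtain a where a: "\<And>x. x \<in> M \<Longrightarrow> f' x = a * h x" by blast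
  have "f x = (\<Sum>g\<in>insert h G. (c(h := a)) g * g x)" if "x \<in> M" for x
  proof -
    have "(\<Sum>g\<in>G. (c(h := a)) g * g x) = (\<Sum>g\<in>G. c g * g x)"
      using insert.hyps by (intro sum.cong) auto
    then show ?thesis
      using a[OF that] insert.hyps by (simp add: f'_def algebra_simps fun_upd_same del: fun_upd_apply)
  qed
  then show ?case by blast
qed

lemma linear_on_nuclear_functional:
  assumes "f \<in> nuclear_functionals"
  shows "linear_on A f"
proof -
  obtain \<xi> \<eta> where *: "summable (\<lambda>n. (norm (\<xi> n))\<^sup>2)" "summable (\<lambda>n. (norm (\<eta> n))\<^sup>2)"
    "f = (\<lambda>x. \<Sum>n. cinner (blinfun_apply x (\<xi> n)) (\<eta> n))" using assms by blast
  have s: "summable (\<lambda>n. cinner (blinfun_apply x (\<xi> n)) (\<eta> n))" for x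
    by (rule summable_norm_cancel, rule cinner_series_bound(1)[OF *(1) max.cobounded1 *(2) max.cobounded2])
  show ?thesis
    unfolding linear_on_def *(3)
    by (simp add: blinfun.add_left cinner_add_left suminf_add[symmetric] s scaleC_blinfun.rep_eq cinner_scaleC_left
        suminf_mult scaleC_complex_def)
qed

text \<open>Continuity at \<open>0\<close> bounds \<open>f\<close> on a set cut out by finitely many generators. By scaling, \<open>f\<close> vanishes
  where they all vanish, so on \<open>M\<close> it is one of their linear combinations.\<close>
lemma normal_functional_nuclear:
  assumes M: "M \<subseteq> bounded_ops" "complex_vector.subspace M" and f: "normal_functional M f"
  obtains C where "nuclear_on M C f"
proof -
  have lin: "linear_on M f" and cont: "continuous_map (subtopology ultraweak_topology M) euclidean f"
    using f by (auto simp: normal_functional_def)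
  have f0: "f 0 = 0"
    using linear_on_scaleC[OF lin complex_subspaceD(1)[OF M(2)], of 0] by (simp add: scaleC_complex_def)
  have "openin (subtopology ultraweak_topology M) {x \<in> topspace (subtopology ultraweak_topology M). f x \<in> ball 0 1}"
    by (rule openin_continuous_map_preimage[OF cont]) simp
  moreover have "bounded_ops \<inter> M = M" using M(1) by auto
  moreover have "{x \<in> M. f x \<in> ball 0 1} = {x \<in> M. cmod (f x) < 1}" by auto
  ultimately have "openin (subtopology (initial_topology nuclear_functionals) M) {x \<in> M. cmod (f x) < 1}"
    unfolding ultraweak_topology_def subtopology_subtopology
    by (simp only: topspace_subtopology topspace_initial_topology[OF nuclear_functionals_nonempty] Int_UNIV_left)
  then obtain U where U: "openin (initial_topology nuclear_functionals) U"
    and eq: "{x \<in> M. cmod (f x) < 1} = U \<inter> M"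
    unfolding openin_subtopology by (elim exE conjE) (rule that)
  have "0 \<in> {x \<in> M. cmod (f x) < 1}" using f0 complex_subspaceD(1)[OF M(2)] by simp
  then have "0 \<in> U" unfolding eq by (rule IntD1)
  from open_in_initial_topology_nbhd[OF U this] obtain G e where G: "finite G" "G \<subseteq> nuclear_functionals" "e > 0"
    and nb: "\<forall>y. (\<forall>g\<in>G. cmod (g y - g 0) < e) \<longrightarrow> y \<in> U"
    by (elim exE conjE) (rule that)
  have "f x = 0" if x: "x \<in> M" and 0: "\<forall>g\<in>G. g x = 0" for x
  proof (rule ccontr)
    assume nz: "f x \<noteq> 0"
    let ?y = "(1 / f x) *\<^sub>C x"
    have d: "g ?y - g 0 = 0" if "g \<in> G" for g
    proof -
      have lg: "linear_on UNIV g" using that G(2) linear_on_nuclear_functional by blast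
      have "g (0 *\<^sub>C 0) = 0 * g 0" by (simp only: linear_on_scaleC[OF lg UNIV_I] scaleC_complex_def)
      then show ?thesis using linear_on_scaleC[OF lg UNIV_I, of "1 / f x" x] 0 that by (simp add: scaleC_complex_def)
    qed
    have "?y \<in> U"
      by (rule nb[rule_format]) (simp only: d norm_zero G(3))
    moreover have "?y \<in> M" using x M(2) complex_subspaceD(3) by blast
    ultimately have "cmod (f ?y) < 1" using eq by blast
    then show False using nz linear_on_scaleC[OF lin x, of "1 / f x"] by (simp add: scaleC_complex_def)
  qed
  then obtain c where c: "\<forall>x\<in>M. f x = (\<Sum>g\<in>G. c g * g x)"
    using linear_combination_of_kernel_inclusion[OF G(1) M(2) lin] G(2) linear_on_nuclear_functional by blast
  have "\<forall>g\<in>G. \<exists>C. nuclear_on M C g" using G(2) nuclear_functional_nuclear_on by blast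
  then obtain C where "\<And>g. g \<in> G \<Longrightarrow> nuclear_on M (C g) g" by metis
  then have "nuclear_on M (\<Sum>g\<in>G. cmod (c g) * C g) (\<lambda>a. \<Sum>g\<in>G. c g * g a)"
    using G(1) by (intro nuclear_on_sum nuclear_on_scale)
  then have "nuclear_on M (\<Sum>g\<in>G. cmod (c g) * C g) f"
    by (rule nuclear_on_cong) (use c in simp)
  then show ?thesis by (rule that)
qed

lemma von_neumann_algebraD:
  assumes "von_neumann_algebra M"
  shows "M \<subseteq> bounded_ops" "complex_vector.subspace M" "id_blinfun \<in> M" "a \<in> M \<Longrightarrow> adj a \<in> M"
  using assms by (auto simp: von_neumann_algebra_def)

text \<open>The ultraweak topology refines the weak operator topology.\<close>
lemma von_neumann_algebra_ultraweak_closed: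
  fixes M :: "('h::complex_hilbert_space \<Rightarrow>\<^sub>L 'h) set"
  assumes "von_neumann_algebra M"
  shows "closedin ultraweak_topology M"
proof -
  have ne: "(vector_functionals :: (('h \<Rightarrow>\<^sub>L 'h) \<Rightarrow> complex) set) \<noteq> {}" by auto
  have "continuous_map ultraweak_topology (initial_topology vector_functionals) (id :: ('h \<Rightarrow>\<^sub>L 'h) \<Rightarrow> _)"
  proof (rule continuous_map_into_initial_topology[OF ne])
    fix f :: "('h \<Rightarrow>\<^sub>L 'h) \<Rightarrow> complex" assume "f \<in> vector_functionals"
    then obtain \<xi> \<eta> where "f = (\<lambda>x. cinner (blinfun_apply x \<xi>) \<eta>)" by blast
    then show "continuous_map ultraweak_topology euclidean (\<lambda>x. f (id x))"
      using nuclear_on_continuous[OF nuclear_on_vector[of UNIV \<xi> \<eta>]] by simp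
  qed
  then have "continuous_map ultraweak_topology weak_op_topology (id :: ('h \<Rightarrow>\<^sub>L 'h) \<Rightarrow> _)"
    unfolding weak_op_topology_def continuous_map_in_subtopology by (simp add: topspace_ultraweak)
  then have "closedin ultraweak_topology {x \<in> topspace ultraweak_topology. id x \<in> M}"
    by (rule closedin_continuous_map_preimage) (use assms in \<open>simp add: von_neumann_algebra_def\<close>)
  moreover have "{x \<in> topspace ultraweak_topology. id x \<in> M} = M"
    using assms by (auto simp: von_neumann_algebra_def topspace_ultraweak)
  ultimately show ?thesis by simp
qed

section \<open>Operators on a Hilbert tensor product\<close>

lemma bounded_operator_extension:
  fixes f :: "'a::complex_hilbert_space \<Rightarrow> 'a"
  assumes S: "complex_vector.subspace S" "closure S = UNIV"
    and add: "\<And>x y. x \<in> S \<Longrightarrow> y \<in> S \<Longrightarrow> f (x + y) = f x + f y"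
    and scale: "\<And>c x. x \<in> S \<Longrightarrow> f (c *\<^sub>C x) = c *\<^sub>C f x"
    and bound: "\<And>x. x \<in> S \<Longrightarrow> norm (f x) \<le> K * norm x" and K: "K \<ge> 0"
  obtains A where "A \<in> bounded_ops" "norm A \<le> K" "\<And>x. x \<in> S \<Longrightarrow> blinfun_apply A x = f x"
proof -
  have diff: "f (x - y) = f x - f y" if "x \<in> S" "y \<in> S" for x y
    using linear_on_diff[OF S(1), of f x y] add scale that by (simp add: linear_on_def)
  have "uniformly_continuous_on S f"
    unfolding uniformly_continuous_on_def
  proof (intro allI impI)
    fix e :: real assume e: "e > 0"
    have "dist (f y) (f x) < e" if "x \<in> S" "y \<in> S" "dist y x < e / (K + 1)" for x y
    proof -
      have "dist (f y) (f x) \<le> K * norm (y - x)"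
        unfolding dist_norm using diff that bound complex_subspace_diff[OF S(1)] by metis
      also have "\<dots> \<le> (K + 1) * norm (y - x)" by (intro mult_right_mono) auto
      also have "\<dots> < e" using that(3) K by (simp add: dist_norm field_simps)
      finally show ?thesis .
    qed
    then show "\<exists>d>0. \<forall>x\<in>S. \<forall>y\<in>S. dist y x < d \<longrightarrow> dist (f y) (f x) < e"
      using e K by (intro exI[of _ "e / (K + 1)"]) auto
  qed
  then obtain g where g: "uniformly_continuous_on (closure S) g" "\<And>x. x \<in> S \<Longrightarrow> f x = g x"
    using uniformly_continuous_on_extension_on_closure by metis
  then have "continuous_on UNIV g" using S(2) uniformly_continuous_imp_continuous by metis
  then have cg: "(\<lambda>n. g (x n)) \<longlonglongrightarrow> g y" if "x \<longlonglongrightarrow> y" for x y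
    using that by (metis UNIV_I continuous_on_tendsto_compose eventually_sequentiallyI)
  have seq: "\<exists>s. (\<forall>n. s n \<in> S) \<and> s \<longlonglongrightarrow> x" for x
    using S(2) closure_sequential[of x S] by auto
  have lim: "(\<lambda>n. f (s n)) \<longlonglongrightarrow> g x" if "\<forall>n. s n \<in> S" "s \<longlonglongrightarrow> x" for s x
    using cg[OF that(2)] that(1) g(2) by simp
  have gadd: "g (x + y) = g x + g y" for x y
  proof -
    obtain s u where s: "\<forall>n. s n \<in> S" "s \<longlonglongrightarrow> x" and u: "\<forall>n. u n \<in> S" "u \<longlonglongrightarrow> y" using seq by metis
    have "(\<lambda>n. f (s n + u n)) \<longlonglongrightarrow> g (x + y)"
      using s u complex_subspaceD(2)[OF S(1)] by (intro lim tendsto_add) auto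
    moreover have "(\<lambda>n. f (s n + u n)) \<longlonglongrightarrow> g x + g y"
      using tendsto_add[OF lim[OF s] lim[OF u]] s(1) u(1) by (simp add: add)
    ultimately show ?thesis by (rule LIMSEQ_unique)
  qed
  have tc: "(\<lambda>n. c *\<^sub>C s n) \<longlonglongrightarrow> c *\<^sub>C x" if "s \<longlonglongrightarrow> x" for c and s :: "nat \<Rightarrow> 'a" and x
  proof -
    have "(\<lambda>n. cmod c * norm (s n - x)) \<longlonglongrightarrow> cmod c * 0"
      using that by (intro tendsto_mult tendsto_const) (simp add: LIM_zero_iff tendsto_norm_zero_iff)
    then have "(\<lambda>n. norm (c *\<^sub>C s n - c *\<^sub>C x)) \<longlonglongrightarrow> 0"
      by (simp add: norm_scaleC flip: complex_vector.scale_right_diff_distrib)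
    then show ?thesis by (simp add: LIM_zero_iff tendsto_norm_zero_iff)
  qed
  have gscale: "g (c *\<^sub>C x) = c *\<^sub>C g x" for c x
  proof -
    obtain s where s: "\<forall>n. s n \<in> S" "s \<longlonglongrightarrow> x" using seq by metis
    have "(\<lambda>n. f (c *\<^sub>C s n)) \<longlonglongrightarrow> g (c *\<^sub>C x)"
      using s complex_subspaceD(3)[OF S(1)] tc by (intro lim) auto
    moreover have "(\<lambda>n. f (c *\<^sub>C s n)) \<longlonglongrightarrow> c *\<^sub>C g x"
      using tc[OF lim[OF s]] s(1) by (simp add: scale)
    ultimately show ?thesis by (rule LIMSEQ_unique)
  qed
  have gbound: "norm (g x) \<le> norm x * K" for x
  proof -
    obtain s where s: "\<forall>n. s n \<in> S" "s \<longlonglongrightarrow> x" using seq by metis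
    show ?thesis
      by (rule LIMSEQ_le[OF tendsto_norm[OF lim[OF s]] tendsto_mult_right[OF tendsto_norm[OF s(2)]]])
        (use bound s(1) in \<open>auto simp: mult.commute\<close>)
  qed
  have bl: "bounded_linear g"
    by (rule bounded_linear_intro[OF gadd _ gbound]) (simp add: scaleR_scaleC[where 'a='a] gscale)
  show ?thesis
  proof
    show "Blinfun g \<in> bounded_ops" using bl by (simp add: bounded_ops_def bounded_linear_Blinfun_apply gscale)
    show "norm (Blinfun g) \<le> K"
      using K gbound bl by (intro norm_blinfun_bound) (auto simp: bounded_linear_Blinfun_apply mult.commute)
    show "blinfun_apply (Blinfun g) x = f x" if "x \<in> S" for x
      using bl g(2)[OF that] by (simp add: bounded_linear_Blinfun_apply)
  qed
qed

lemma sum_in_nonneg_Reals: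
  fixes f :: "'a \<Rightarrow> complex"
  shows "(\<And>i. i \<in> I \<Longrightarrow> f i \<in> \<real>\<^sub>\<ge>\<^sub>0) \<Longrightarrow> sum f I \<in> \<real>\<^sub>\<ge>\<^sub>0"
  by (induction I rule: infinite_finite_induct) (auto intro: nonneg_Reals_add_I)

lemma norm_sum_orthogonal:
  fixes z :: "nat \<Rightarrow> 'a::complex_inner"
  assumes "\<And>i j. i < n \<Longrightarrow> j < n \<Longrightarrow> i \<noteq> j \<Longrightarrow> cinner (z i) (z j) = 0"
  shows "(norm (\<Sum>i<n. z i))\<^sup>2 = (\<Sum>i<n. (norm (z i))\<^sup>2)"
  using assms
proof (induction n)
  case (Suc n)
  have "cinner (\<Sum>i<n. z i) (z n) = 0"
    using Suc.prems by (simp add: cinner.sum_left)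
  then show ?case using Suc by (simp add: norm_add_square)
qed simp

locale tensor_product =
  fixes t :: "'h::complex_hilbert_space \<Rightarrow> 'k::complex_hilbert_space \<Rightarrow> 't::complex_hilbert_space"
  assumes tensor: "hilbert_tensor t"
begin

lemma add_left: "t (x + x') y = t x y + t x' y"
  and add_right: "t x (y + y') = t x y + t x y'"
  and scale_left: "t (c *\<^sub>C x) y = c *\<^sub>C t x y"
  and scale_right: "t x (c *\<^sub>C y) = c *\<^sub>C t x y"
  and cinner_tensor: "cinner (t x y) (t x' y') = cinner x x' * cinner y y'"
  and dense: "closure (complex_vector.span {t x y | x y. True}) = UNIV"
  using tensor unfolding hilbert_tensor_def linear_on_def by auto

lemma norm_tensor: "norm (t x y) = norm x * norm y"
proof -
  have "complex_of_real ((norm (t x y))\<^sup>2) = complex_of_real ((norm x * norm y)\<^sup>2)"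
    unfolding cinner_self[symmetric] cinner_tensor by (simp add: cinner_self power_mult_distrib)
  then show ?thesis unfolding of_real_eq_iff by (rule power2_eq_imp_eq) auto
qed

lemma zero_left [simp]: "t 0 y = 0" and zero_right [simp]: "t x 0 = 0"
  using norm_tensor[of 0 y] norm_tensor[of x 0] by simp_all

lemma sum_left: "t (\<Sum>i\<in>I. x i) y = (\<Sum>i\<in>I. t (x i) y)"
  by (induction I rule: infinite_finite_induct) (auto simp: add_left)

text \<open>Gram--Schmidt: expanding the right factors of a finite sum of simple tensors in an orthogonal
  family turns norms into sums of squares. The same expansion serves every operator on the left
  factor.\<close>

lemma orthogonal_expansion:
  fixes x :: "nat \<Rightarrow> 'h" and y :: "nat \<Rightarrow> 'k"
  obtains x' e where "\<And>i j. i < n \<Longrightarrow> j < n \<Longrightarrow> i \<noteq> j \<Longrightarrow> cinner (e i) (e j) = 0"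
    and "\<And>i. i < n \<Longrightarrow> norm (e i) \<le> 1" "\<And>i. i < n \<Longrightarrow> x' i \<noteq> 0 \<Longrightarrow> norm (e i) = 1"
    and "\<And>a. a \<in> bounded_ops \<Longrightarrow>
      (\<Sum>i<n. t (blinfun_apply a (x i)) (y i)) = (\<Sum>i<n. t (blinfun_apply a (x' i)) (e i))"
proof -
  (* The third conjunct keeps the new family orthogonal to the vector split off in the induction step. *)
  have "\<exists>x' e. (\<forall>i<n. \<forall>j<n. i \<noteq> j \<longrightarrow> cinner (e i) (e j) = 0) \<and>
    (\<forall>i<n. norm (e i) \<le> 1 \<and> (x' i \<noteq> 0 \<longrightarrow> norm (e i) = 1)) \<and>
    (\<forall>v. (\<forall>i<n. cinner (y i) v = 0) \<longrightarrow> (\<forall>i<n. cinner (e i) v = 0)) \<and>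
    (\<forall>a\<in>bounded_ops.
      (\<Sum>i<n. t (blinfun_apply a (x i)) (y i)) = (\<Sum>i<n. t (blinfun_apply a (x' i)) (e i)))"
  proof (induction n arbitrary: y)
    case 0
    show ?case by simp
  next
    case (Suc n)
    (* Division by zero yields c i = 0 and e' n = 0 when u = 0, which is what that case requires. *)
    define u where "u = y n"
    define c where "c i = cinner (y i) u / (norm u)\<^sup>2" for i
    define z where "z i = y i - c i *\<^sub>C u" for i
    have y_eq: "y i = z i + c i *\<^sub>C u" for i by (simp add: z_def)
    have zu: "cinner (z i) u = 0" for i
    proof -
      have "cinner (y i) u = cinner (z i) u + c i * cinner u u"
        by (subst y_eq) (simp add: cinner_add_left cinner_scaleC_left)
      moreover have "c i * cinner u u = cinner (y i) u"
        by (cases "u = 0") (auto simp: c_def cinner_self cinner.zero_right)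
      ultimately show ?thesis by simp
    qed
    obtain x' e where orth: "\<And>i j. i < n \<Longrightarrow> j < n \<Longrightarrow> i \<noteq> j \<Longrightarrow> cinner (e i) (e j) = 0"
      and nrm: "\<And>i. i < n \<Longrightarrow> norm (e i) \<le> 1 \<and> (x' i \<noteq> 0 \<longrightarrow> norm (e i) = 1)"
      and perp: "\<And>v i. (\<forall>i<n. cinner (z i) v = 0) \<Longrightarrow> i < n \<Longrightarrow> cinner (e i) v = 0"
      and exp: "\<And>a. a \<in> bounded_ops \<Longrightarrow>
        (\<Sum>i<n. t (blinfun_apply a (x i)) (z i)) = (\<Sum>i<n. t (blinfun_apply a (x' i)) (e i))"
      using Suc.IH[of z] by (elim exE conjE) (rule that; simp)
    define w where "w = x n + (\<Sum>i<n. c i *\<^sub>C x i)"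
    define e' where "e' = e(n := complex_of_real (inverse (norm u)) *\<^sub>C u)"
    define x'' where "x'' = x'(n := complex_of_real (norm u) *\<^sub>C w)"
    have eu: "cinner (e i) (e' n) = 0" "cinner (e' n) (e i) = 0" if "i < n" for i
    proof -
      show "cinner (e i) (e' n) = 0"
        using perp[of u i] zu that by (simp add: e'_def cinner_scaleC_right)
      then show "cinner (e' n) (e i) = 0" by (metis cinner_commute complex_cnj_zero)
    qed
    have "cinner (e' i) (e' j) = 0" if "i < Suc n" "j < Suc n" "i \<noteq> j" for i j
      using that eu orth by (cases "i = n"; cases "j = n") (auto simp: e'_def less_Suc_eq)
    moreover have "norm (e' i) \<le> 1 \<and> (x'' i \<noteq> 0 \<longrightarrow> norm (e' i) = 1)" if "i < Suc n" for i
      using that nrm by (cases "i = n"; cases "u = 0") (auto simp: e'_def x''_def norm_scaleC norm_inverse less_Suc_eq)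
    moreover have "cinner (e' i) v = 0" if v: "\<forall>i<Suc n. cinner (y i) v = 0" and i: "i < Suc n" for v i
    proof -
      have uv: "cinner u v = 0" using v by (simp add: u_def)
      have "cinner (z i) v = 0" if "i < n" for i
        using v that uv y_eq[of i] by (metis add.right_neutral cinner_add_left cinner_scaleC_left less_SucI mult_zero_right)
      then show ?thesis
        using i uv perp[of v i] by (cases "i = n") (auto simp: e'_def cinner_scaleC_left less_Suc_eq)
    qed
    moreover have "(\<Sum>i<Suc n. t (blinfun_apply a (x i)) (y i)) =
      (\<Sum>i<Suc n. t (blinfun_apply a (x'' i)) (e' i))" if a: "a \<in> bounded_ops" for a
    proof -
      have "t (blinfun_apply a (x'' n)) (e' n) =
        (complex_of_real (norm u) * complex_of_real (inverse (norm u))) *\<^sub>C t (blinfun_apply a w) u"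
        by (simp add: e'_def x''_def bounded_opsD[OF a] scale_left scale_right scaleC_scaleC mult.commute)
      also have "\<dots> = t (blinfun_apply a w) u"
        by (cases "u = 0") (auto simp: scaleC_one)
      also have "\<dots> = t (blinfun_apply a (x n)) u + (\<Sum>i<n. t (blinfun_apply a (x i)) (c i *\<^sub>C u))"
        by (simp add: w_def blinfun.add_right blinfun.sum_right add_left sum_left bounded_opsD[OF a]
            scale_left scale_right)
      finally have last: "t (blinfun_apply a (x'' n)) (e' n) = \<dots>" .
      have "(\<Sum>i<Suc n. t (blinfun_apply a (x i)) (y i)) =
        (\<Sum>i<n. t (blinfun_apply a (x i)) (z i) + t (blinfun_apply a (x i)) (c i *\<^sub>C u)) + t (blinfun_apply a (x n)) u"
        by (simp only: sum.lessThan_Suc add_right[symmetric] y_eq[symmetric] u_def[symmetric])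
      also have "\<dots> = (\<Sum>i<n. t (blinfun_apply a (x' i)) (e i)) + t (blinfun_apply a (x'' n)) (e' n)"
        unfolding last by (simp add: sum.distrib exp[OF a])
      also have "(\<Sum>i<n. t (blinfun_apply a (x' i)) (e i)) = (\<Sum>i<n. t (blinfun_apply a (x'' i)) (e' i))"
        by (intro sum.cong) (auto simp: x''_def e'_def)
      finally show ?thesis by simp
    qed
    ultimately show ?case by (intro exI[of _ x''] exI[of _ e']) blast
  qed
  then show ?thesis by (elim exE conjE) (rule that; simp)
qed

lemma orthogonal_expansion_norm:
  fixes n :: nat
  assumes "\<And>i j. i < n \<Longrightarrow> j < n \<Longrightarrow> i \<noteq> j \<Longrightarrow> cinner (e i) (e j) = 0"
  shows "(norm (\<Sum>i<n. t (w i) (e i)))\<^sup>2 = (\<Sum>i<n. (norm (w i))\<^sup>2 * (norm (e i))\<^sup>2)"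
  using assms by (subst norm_sum_orthogonal) (simp_all add: cinner_tensor norm_tensor power_mult_distrib)

lemma norm_left_operator_sum:
  fixes n :: nat
  assumes a: "a \<in> bounded_ops"
  shows "norm (\<Sum>i<n. t (blinfun_apply a (x i)) (y i)) \<le> norm a * norm (\<Sum>i<n. t (x i) (y i))"
proof -
  obtain x' e where orth: "\<And>i j. i < n \<Longrightarrow> j < n \<Longrightarrow> i \<noteq> j \<Longrightarrow> cinner (e i) (e j) = 0"
    and exp: "\<And>a. a \<in> bounded_ops \<Longrightarrow>
      (\<Sum>i<n. t (blinfun_apply a (x i)) (y i)) = (\<Sum>i<n. t (blinfun_apply a (x' i)) (e i))"
    by (rule orthogonal_expansion[of n x y]) (rule that)
  have pyth: "(norm (\<Sum>i<n. t (w i) (e i)))\<^sup>2 = (\<Sum>i<n. (norm (w i))\<^sup>2 * (norm (e i))\<^sup>2)" for w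
    by (rule orthogonal_expansion_norm[OF orth])
  have "(norm (\<Sum>i<n. t (blinfun_apply a (x i)) (y i)))\<^sup>2 = (\<Sum>i<n. (norm (blinfun_apply a (x' i)))\<^sup>2 * (norm (e i))\<^sup>2)"
    unfolding exp[OF a] by (rule pyth)
  also have "\<dots> \<le> (\<Sum>i<n. (norm a * norm (x' i))\<^sup>2 * (norm (e i))\<^sup>2)"
    by (intro sum_mono mult_right_mono power_mono norm_blinfun) auto
  also have "\<dots> = (norm a)\<^sup>2 * (norm (\<Sum>i<n. t (x' i) (e i)))\<^sup>2"
    unfolding pyth by (simp add: sum_distrib_left power_mult_distrib mult.assoc)
  also have "(\<Sum>i<n. t (x' i) (e i)) = (\<Sum>i<n. t (x i) (y i))"
    using exp[OF id_in_bounded_ops] by simp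
  finally have "(norm (\<Sum>i<n. t (blinfun_apply a (x i)) (y i)))\<^sup>2 \<le> (norm a * norm (\<Sum>i<n. t (x i) (y i)))\<^sup>2"
    by (simp only: power_mult_distrib)
  then show ?thesis by (rule power2_le_imp_le) simp
qed

text \<open>The graph of \<open>a \<otimes> 1\<close> on the algebraic tensor product.\<close>

inductive left_graph :: "('h \<Rightarrow>\<^sub>L 'h) \<Rightarrow> 't \<Rightarrow> 't \<Rightarrow> bool" for a where
  zero: "left_graph a 0 0"
| step: "left_graph a z w \<Longrightarrow> left_graph a (t x y + z) (t (blinfun_apply a x) y + w)"

lemma left_graph_add: "left_graph a z w \<Longrightarrow> left_graph a z' w' \<Longrightarrow> left_graph a (z + z') (w + w')"
  by (induction rule: left_graph.induct) (auto simp: add.assoc intro: left_graph.intros)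

lemma left_graph_scale:
  assumes "left_graph a z w" "a \<in> bounded_ops"
  shows "left_graph a (c *\<^sub>C z) (c *\<^sub>C w)"
  using assms(1)
proof induction
  case (step z w x y)
  then show ?case using left_graph.step[of a "c *\<^sub>C z" "c *\<^sub>C w" "c *\<^sub>C x" y]
    by (simp add: scaleC_add_right bounded_opsD[OF assms(2)] scale_left)
qed (simp add: left_graph.zero)

lemma left_graph_sum:
  "left_graph a z w \<Longrightarrow> \<exists>n x y. z = (\<Sum>i<n. t (x i) (y i)) \<and> w = (\<Sum>i<n. t (blinfun_apply a (x i)) (y (i::nat)))"
proof (induction rule: left_graph.induct)
  case zero
  show ?case by (rule exI[of _ 0]) simp
next
  case (step z w x y)
  then obtain n xs ys where "z = (\<Sum>i<n. t (xs i) (ys i))" "w = (\<Sum>i<n. t (blinfun_apply a (xs i)) (ys (i::nat)))"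
    by blast
  then have "t x y + z = (\<Sum>i<Suc n. t ((xs(n := x)) i) ((ys(n := y)) i))"
    "t (blinfun_apply a x) y + w = (\<Sum>i<Suc n. t (blinfun_apply a ((xs(n := x)) i)) ((ys(n := y)) i))"
    by simp_all
  then show ?case by blast
qed

lemma left_graph_total: "z \<in> complex_vector.span {t x y | x y. True} \<Longrightarrow> \<exists>w. left_graph a z w"
proof (induction rule: complex_vector.span_induct_alt)
  case base
  then show ?case using left_graph.zero by blast
next
  case (step c x z)
  then obtain u v w where "x = t u v" "left_graph a z w" by blast
  then show ?case using left_graph.step[of a z w "c *\<^sub>C u" v] by (auto simp: scale_left)
qed

lemma span_sum:
  assumes "z \<in> complex_vector.span {t x y | x y. True}"
  obtains n x y where "z = (\<Sum>i<n. t (x i) (y (i::nat)))"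
  using left_graph_total[OF assms, of id_blinfun] left_graph_sum by metis

text \<open>By the norm estimate the graph of \<open>a \<otimes> 1\<close> on the algebraic tensor product is single valued and its
  function is bounded, hence extends to the closure.\<close>
lemma left_operator:
  assumes a: "a \<in> bounded_ops"
  obtains A where "A \<in> bounded_ops" "norm A \<le> norm a" "\<And>x y. blinfun_apply A (t x y) = t (blinfun_apply a x) y"
proof -
  let ?S = "complex_vector.span {t x y | x y. True}"
  have bound: "norm w \<le> norm a * norm z" if "left_graph a z w" for z w
    using left_graph_sum[OF that] norm_left_operator_sum[OF a] by blast
  have unique: "w = w'" if "left_graph a z w" "left_graph a z w'" for z w w'
  proof -
    have "left_graph a (z + (- 1) *\<^sub>C z) (w + (- 1) *\<^sub>C w')"
      using left_graph_scale[OF that(2) a] by (rule left_graph_add[OF that(1)])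
    from bound[OF this] show ?thesis by (simp add: scaleC_minus_one)
  qed
  define f where "f z = (THE w. left_graph a z w)" for z
  have f_eq: "f z = w" if "left_graph a z w" for z w
    unfolding f_def using that by (rule the_equality) (rule unique[OF _ that])
  have f: "left_graph a z (f z)" if "z \<in> ?S" for z
    using left_graph_total[OF that] f_eq by metis
  obtain A where A: "A \<in> bounded_ops" "norm A \<le> norm a" "\<And>z. z \<in> ?S \<Longrightarrow> blinfun_apply A z = f z"
  proof (rule bounded_operator_extension[OF complex_vector.subspace_span dense, of f "norm a"])
    show "f (x + y) = f x + f y" if "x \<in> ?S" "y \<in> ?S" for x y
      using that by (intro f_eq left_graph_add f)
    show "f (c *\<^sub>C x) = c *\<^sub>C f x" if "x \<in> ?S" for c x
      using that by (intro f_eq left_graph_scale f a)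
    show "norm (f x) \<le> norm a * norm x" if "x \<in> ?S" for x
      using that by (intro bound f)
  qed auto
  show ?thesis
  proof (rule that[OF A(1,2)])
    fix x y
    have "f (t x y) = t (blinfun_apply a x) y"
      using left_graph.step[OF left_graph.zero, of a x y] by (intro f_eq) simp
    moreover have "t x y \<in> ?S" by (rule complex_vector.span_base) blast
    ultimately show "blinfun_apply A (t x y) = t (blinfun_apply a x) y" using A(3) by simp
  qed
qed

lemma swap: "tensor_product (\<lambda>y x. t x y)"
proof
  have "{t x y | y x. True} = {t x y | x y. True}" by blast
  then show "hilbert_tensor (\<lambda>y x. t x y)"
    using tensor unfolding hilbert_tensor_def by (auto simp: mult.commute)
qed

lemma orthogonal_to_simple_tensors:
  assumes "\<And>x y. cinner z (t x y) = 0"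
  shows "z = 0"
proof -
  let ?S = "complex_vector.span {t x y | x y. True}"
  have "cinner z w = 0" if "w \<in> ?S" for w
    using that
  proof (induction rule: complex_vector.span_induct_alt)
    case base
    then show ?case by (rule cinner.zero_right)
  next
    case (step c x y)
    then show ?case using assms by (auto simp: cinner_add_right cinner_scaleC_right)
  qed
  then have "?S \<subseteq> {w. cinner z w = 0}" by blast
  moreover have "closed {w. cinner z w = 0}"
    by (intro closed_Collect_eq continuous_intros cinner.continuous_on)
  ultimately have "closure ?S \<subseteq> {w. cinner z w = 0}" by (rule closure_minimal)
  then have "cinner z z = 0" using dense by auto
  then show ?thesis by (simp add: cinner_self)
qed

lemma operator_eqI:
  assumes c: "c \<in> bounded_ops" "d \<in> bounded_ops"
    and eq: "\<And>x y. blinfun_apply c (t x y) = blinfun_apply d (t x y)"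
  shows "c = d"
proof (rule blinfun_eqI)
  fix z
  have b: "c - d \<in> bounded_ops" using c by (rule complex_subspace_diff[OF subspace_bounded_ops])
  have "cinner (blinfun_apply (adj (c - d)) w) (t x y) = 0" for w x y
    using cinner_adj[OF b, of "t x y" w] eq
    by (metis blinfun.diff_left cinner.zero_left cinner_commute complex_cnj_zero diff_self)
  then have "blinfun_apply (adj (c - d)) w = 0" for w by (rule orthogonal_to_simple_tensors)
  then have "cinner (blinfun_apply (c - d) z) w = 0" for w
    using cinner_adj[OF b, of z w] by (simp add: cinner.zero_right)
  from this[of "blinfun_apply (c - d) z"] show "blinfun_apply c z = blinfun_apply d z"
    by (simp add: cinner_self blinfun.diff_left)
qed

lemma tensor_op:
  assumes a: "a \<in> bounded_ops" and b: "b \<in> bounded_ops"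
  shows tensor_op_bounded: "tensor_op t a b \<in> bounded_ops"
    and tensor_op_apply: "blinfun_apply (tensor_op t a b) (t x y) = t (blinfun_apply a x) (blinfun_apply b y)"
proof -
  interpret s: tensor_product "\<lambda>y x. t x y" by (rule swap)
  obtain A where A: "A \<in> bounded_ops" "\<And>x y. blinfun_apply A (t x y) = t (blinfun_apply a x) y"
    by (rule left_operator[OF a]) (rule that)
  obtain B where B: "B \<in> bounded_ops" "\<And>x y. blinfun_apply B (t x y) = t x (blinfun_apply b y)"
    by (rule s.left_operator[OF b]) (rule that)
  let ?P = "\<lambda>c. c \<in> bounded_ops \<and> (\<forall>x y. blinfun_apply c (t x y) = t (blinfun_apply a x) (blinfun_apply b y))"
  have "?P (A o\<^sub>L B)"
    using A B by (auto simp: bounded_ops_def)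
  moreover have "c = A o\<^sub>L B" if "?P c" for c
    using that calculation by (intro operator_eqI) auto
  ultimately have "?P (tensor_op t a b)" unfolding tensor_op_def by (rule theI)
  then show "tensor_op t a b \<in> bounded_ops"
    "blinfun_apply (tensor_op t a b) (t x y) = t (blinfun_apply a x) (blinfun_apply b y)" by auto
qed

lemma tensor_op_eqI:
  assumes "a \<in> bounded_ops" "b \<in> bounded_ops" "c \<in> bounded_ops"
    and "\<And>x y. blinfun_apply c (t x y) = t (blinfun_apply a x) (blinfun_apply b y)"
  shows "tensor_op t a b = c"
  using assms by (intro operator_eqI) (auto simp: tensor_op)

lemma tensor_op_id: "tensor_op t id_blinfun id_blinfun = id_blinfun"
  by (rule tensor_op_eqI) (auto simp: id_in_bounded_ops)

lemma norm_tensor_op_id_le: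
  assumes "a \<in> bounded_ops"
  shows "norm (tensor_op t a id_blinfun) \<le> norm a"
proof -
  obtain A where "A \<in> bounded_ops" "norm A \<le> norm a" "\<And>x y. blinfun_apply A (t x y) = t (blinfun_apply a x) y"
    by (rule left_operator[OF assms]) (rule that)
  then show ?thesis using tensor_op_eqI[OF assms id_in_bounded_ops, of A] by simp
qed

lemma linear_tensor_op_id: "linear_on bounded_ops (\<lambda>a. tensor_op t a id_blinfun)"
  unfolding linear_on_def
proof (intro conjI ballI allI)
  fix a b :: "'h \<Rightarrow>\<^sub>L 'h" and c assume a: "a \<in> bounded_ops" and b: "b \<in> bounded_ops"
  note S = complex_subspaceD[OF subspace_bounded_ops]
  show "tensor_op t (a + b) id_blinfun = tensor_op t a id_blinfun + tensor_op t b id_blinfun"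
    using a b by (intro tensor_op_eqI)
      (auto simp: S tensor_op id_in_bounded_ops blinfun.add_left add_left)
next
  fix a :: "'h \<Rightarrow>\<^sub>L 'h" and c assume a: "a \<in> bounded_ops"
  note S = complex_subspaceD[OF subspace_bounded_ops]
  show "tensor_op t (c *\<^sub>C a) id_blinfun = c *\<^sub>C tensor_op t a id_blinfun"
    using a by (intro tensor_op_eqI)
      (auto simp: S tensor_op id_in_bounded_ops scaleC_blinfun.rep_eq scale_left)
qed

lemma tensor_op_id_sum:
  assumes "a \<in> bounded_ops"
  shows "blinfun_apply (tensor_op t a id_blinfun) (\<Sum>i<n. t (x i) (y i)) = (\<Sum>i<n. t (blinfun_apply a (x i)) (y i))"
  using assms by (simp add: blinfun.sum_right tensor_op id_in_bounded_ops)

text \<open>On an orthogonal expansion \<open>z = \<Sum>i. x\<^sub>i \<otimes> e\<^sub>i\<close> the cross terms of \<open>\<langle>(a \<otimes> 1) z, z\<rangle>\<close> vanish, which leaves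
  \<open>\<Sum>i. \<langle>a x\<^sub>i, x\<^sub>i\<rangle> \<parallel>e\<^sub>i\<parallel>\<^sup>2\<close>.\<close>
lemma pos_tensor_op_id:
  assumes a: "a \<in> bounded_ops" and pos: "pos_op a"
  shows "pos_op (tensor_op t a id_blinfun)"
proof -
  let ?S = "complex_vector.span {t x y | x y. True}" and ?A = "tensor_op t a id_blinfun"
  have "cinner (blinfun_apply ?A z) z \<in> \<real>\<^sub>\<ge>\<^sub>0" if zS: "z \<in> ?S" for z
  proof -
    obtain n x y where z: "z = (\<Sum>i<n. t (x i) (y (i::nat)))" using span_sum[OF zS] by blast
    obtain x' e where orth: "\<And>i j. i < n \<Longrightarrow> j < n \<Longrightarrow> i \<noteq> j \<Longrightarrow> cinner (e i) (e j) = 0"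
      and exp: "\<And>a. a \<in> bounded_ops \<Longrightarrow>
        (\<Sum>i<n. t (blinfun_apply a (x i)) (y i)) = (\<Sum>i<n. t (blinfun_apply a (x' i)) (e i))"
      by (rule orthogonal_expansion[of n x y]) (rule that)
    have z': "z = (\<Sum>i<n. t (x' i) (e i))" using z exp[OF id_in_bounded_ops] by simp
    have "cinner (blinfun_apply ?A z) z = (\<Sum>i<n. \<Sum>j<n. cinner (blinfun_apply a (x' i)) (x' j) * cinner (e i) (e j))"
      unfolding z' tensor_op_id_sum[OF a] cinner.sum_left by (simp only: cinner.sum_right cinner_tensor)
    also have "\<dots> = (\<Sum>i<n. cinner (blinfun_apply a (x' i)) (x' i) * cinner (e i) (e i))"
    proof (intro sum.cong refl)
      fix i assume i: "i \<in> {..<n}"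
      have "(\<Sum>j<n. cinner (blinfun_apply a (x' i)) (x' j) * cinner (e i) (e j)) =
        (\<Sum>j\<in>{i}. cinner (blinfun_apply a (x' i)) (x' j) * cinner (e i) (e j))"
        using i orth by (intro sum.mono_neutral_right) auto
      then show "(\<Sum>j<n. cinner (blinfun_apply a (x' i)) (x' j) * cinner (e i) (e j)) =
        cinner (blinfun_apply a (x' i)) (x' i) * cinner (e i) (e i)" by simp
    qed
    also have "\<dots> \<in> \<real>\<^sub>\<ge>\<^sub>0"
      using pos cinner_self_nonneg by (intro sum_in_nonneg_Reals nonneg_Reals_mult_I) (auto simp: pos_op_def)
    finally show ?thesis .
  qed
  then have "?S \<subseteq> {z. cinner (blinfun_apply ?A z) z \<in> \<real>\<^sub>\<ge>\<^sub>0}" by blast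
  moreover have "closed {z. cinner (blinfun_apply ?A z) z \<in> \<real>\<^sub>\<ge>\<^sub>0}"
  proof -
    have "closed ((\<lambda>z. cinner (blinfun_apply ?A z) z) -` \<real>\<^sub>\<ge>\<^sub>0)"
      by (intro closed_vimage closed_nonneg_Reals_complex cinner.continuous_on continuous_intros)
    then show ?thesis by (simp add: vimage_def)
  qed
  ultimately have "closure ?S \<subseteq> {z. cinner (blinfun_apply ?A z) z \<in> \<real>\<^sub>\<ge>\<^sub>0}" by (rule closure_minimal)
  then show ?thesis using dense by (auto simp: pos_op_def)
qed

lemma left_slice_vector: "\<exists>u. \<forall>x. cinner (t x e) w = cinner x u"
proof -
  have "cmod (cinner (t x e) w) \<le> (norm e * norm w) * norm x" for x
    using Cauchy_Schwarz[of "t x e" w] by (simp add: norm_tensor mult_ac)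
  then obtain u where "\<And>x. cinner (t x e) w = cinner x u"
    by (rule Riesz_representation[rotated 2])
      (auto simp: add_left scale_left cinner_add_left cinner_scaleC_left intro: that)
  then show ?thesis by blast
qed

text \<open>For \<open>z = \<Sum>i. x\<^sub>i \<otimes> e\<^sub>i\<close> with orthogonal \<open>e\<^sub>i\<close>, of norm \<open>1\<close> wherever \<open>x\<^sub>i \<noteq> 0\<close>, one has \<open>\<langle>(a \<otimes> 1) z, w\<rangle> = \<Sum>i. \<langle>a x\<^sub>i, u\<^sub>i\<rangle>\<close>, where \<open>u\<^sub>i\<close> is the
  \<open>e\<^sub>i\<close>-coefficient of \<open>w\<close>. Here \<open>\<Sum>i. \<parallel>x\<^sub>i\<parallel>\<^sup>2 = \<parallel>z\<parallel>\<^sup>2\<close>, and Bessel's inequality bounds the \<open>u\<^sub>i\<close> by \<open>w\<close>.\<close>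
lemma nuclear_on_tensor_op_id_span:
  assumes "z \<in> complex_vector.span {t x y | x y. True}"
  shows "nuclear_on bounded_ops (norm z * norm w)
    (\<lambda>a. cinner (blinfun_apply (tensor_op t a id_blinfun) z) w)"
proof -
  obtain n x y where z: "z = (\<Sum>i<n. t (x i) (y (i::nat)))" using span_sum[OF assms] by blast
  obtain x' e where orth: "\<And>i j. i < n \<Longrightarrow> j < n \<Longrightarrow> i \<noteq> j \<Longrightarrow> cinner (e i) (e j) = 0"
    and le1: "\<And>i. i < n \<Longrightarrow> norm (e i) \<le> 1" and unit: "\<And>i. i < n \<Longrightarrow> x' i \<noteq> 0 \<Longrightarrow> norm (e i) = 1"
    and exp: "\<And>a. a \<in> bounded_ops \<Longrightarrow>
      (\<Sum>i<n. t (blinfun_apply a (x i)) (y i)) = (\<Sum>i<n. t (blinfun_apply a (x' i)) (e i))"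
    by (rule orthogonal_expansion[of n x y]) (rule that)
  have pyth: "(norm (\<Sum>i<n. t (v i) (e i)))\<^sup>2 = (\<Sum>i<n. (norm (v i))\<^sup>2 * (norm (e i))\<^sup>2)" for v
    by (rule orthogonal_expansion_norm[OF orth])
  have z': "z = (\<Sum>i<n. t (x' i) (e i))" using z exp[OF id_in_bounded_ops] by simp
  have nz: "(norm z)\<^sup>2 = (\<Sum>i<n. (norm (x' i))\<^sup>2)"
    unfolding z' pyth
  proof (intro sum.cong refl)
    show "(norm (x' i))\<^sup>2 * (norm (e i))\<^sup>2 = (norm (x' i))\<^sup>2" if "i \<in> {..<n}" for i
      using unit[of i] that by (cases "x' i = 0") auto
  qed
  obtain u where u: "\<And>i x. cinner (t x (e i)) w = cinner x (u i)"
    using left_slice_vector[of "e i" w for i] by metis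
  let ?q = "\<Sum>i<n. t (u i) (e i)" and ?s = "\<Sum>i<n. (norm (u i))\<^sup>2"
  have s: "?s \<le> (norm w)\<^sup>2"
  proof -
    have qw: "cinner ?q w = complex_of_real ?s"
      by (simp add: cinner.sum_left u cinner_self)
    have "?s = cmod (cinner ?q w)"
      unfolding qw norm_of_real by (intro abs_of_nonneg[symmetric] sum_nonneg) simp
    also have "\<dots> \<le> norm ?q * norm w" by (rule Cauchy_Schwarz)
    finally have 1: "?s \<le> norm ?q * norm w" .
    have "(norm ?q)\<^sup>2 \<le> (\<Sum>i<n. (norm (u i))\<^sup>2 * 1)"
      unfolding pyth using le1 by (intro sum_mono mult_left_mono) (auto simp: power_le_one)
    then have 2: "(norm ?q)\<^sup>2 \<le> ?s" by simp
    then have "(norm ?q)\<^sup>2 \<le> norm ?q * norm w" using 1 by linarith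
    then have "norm ?q \<le> norm w" by (cases "norm ?q = 0") (auto simp: power2_eq_square)
    then have "norm ?q * norm w \<le> (norm w)\<^sup>2" by (simp add: power2_eq_square mult_right_mono)
    then show ?thesis using 1 by linarith
  qed
  have "nuclear_on bounded_ops (sqrt (\<Sum>i<n. (norm (x' i))\<^sup>2) * sqrt ?s)
    (\<lambda>a. \<Sum>i<n. cinner (blinfun_apply a (x' i)) (u i))"
    by (rule nuclear_on_finite_sum) simp
  then have "nuclear_on bounded_ops (norm z * norm w) (\<lambda>a. \<Sum>i<n. cinner (blinfun_apply a (x' i)) (u i))"
    by (rule nuclear_on_mono)
      (use s in \<open>auto simp flip: nz intro!: mult_left_mono real_le_lsqrt simp: sum_nonneg\<close>)
  then show ?thesis
  proof (rule nuclear_on_cong)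
    fix a :: "'h \<Rightarrow>\<^sub>L 'h" assume a: "a \<in> bounded_ops"
    show "(\<Sum>i<n. cinner (blinfun_apply a (x' i)) (u i)) = cinner (blinfun_apply (tensor_op t a id_blinfun) z) w"
      unfolding z' tensor_op_id_sum[OF a] by (simp add: cinner.sum_left u)
  qed
qed

text \<open>A general \<open>z\<close> is a sum of differences of algebraic vectors whose norms decay geometrically. The
  factor \<open>4\<close> is what this costs; only its independence of \<open>z\<close> and \<open>w\<close> matters.\<close>
lemma nuclear_on_tensor_op_id:
  "nuclear_on bounded_ops (4 * norm z * norm w)
    (\<lambda>a. cinner (blinfun_apply (tensor_op t a id_blinfun) z) w)"
proof (cases "z = 0")
  case True
  then show ?thesis using nuclear_on_zero by (simp add: cinner.zero_left)
next
  case False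
  let ?S = "complex_vector.span {t x y | x y. True}"
  let ?f = "\<lambda>a z. cinner (blinfun_apply (tensor_op t a id_blinfun) z) w"
  (* Starting the approximating sequence at 0 makes its differences sum up to z. *)
  have "\<exists>s\<in>?S. norm (s - z) \<le> norm z * (1/2)^n \<and> (n = 0 \<longrightarrow> s = 0)" for n
  proof (cases "n = 0")
    case True
    then show ?thesis by (intro bexI[of _ 0]) (auto intro: complex_vector.span_zero)
  next
    case False
    have "z \<in> closure ?S" using dense by simp
    moreover have "norm z * (1/2)^n > 0" using \<open>z \<noteq> 0\<close> by simp
    ultimately obtain s where "s \<in> ?S" "dist s z < norm z * (1/2)^n"
      unfolding closure_approachable by blast
    then show ?thesis using False by (intro bexI[of _ s]) (auto simp: dist_norm)
  qed
  then obtain s where sS: "\<And>n. s n \<in> ?S" and sz: "\<And>n. norm (s n - z) \<le> norm z * (1/2)^n" and s0: "s 0 = 0"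
    by metis
  have half: "(\<lambda>n. norm z * (1/2)^n) \<longlonglongrightarrow> norm z * 0"
    by (intro tendsto_mult tendsto_const LIMSEQ_power_zero) simp
  have lim: "s \<longlonglongrightarrow> z"
    by (rule Lim_transform_bound[where g="\<lambda>n. norm z * (1/2)^n", THEN LIM_zero_cancel])
      (use sz half in auto)
  have d: "norm (s (Suc n) - s n) \<le> 2 * norm z * (1/2)^n" for n
  proof -
    have "norm (s (Suc n) - s n) \<le> norm (s (Suc n) - z) + norm (s n - z)"
      using norm_triangle_ineq4[of "s (Suc n) - z" "s n - z"] by simp
    also have "\<dots> \<le> norm z * (1/2)^Suc n + norm z * (1/2)^n" by (intro add_mono sz)
    also have "\<dots> \<le> norm z * (1/2)^n + norm z * (1/2)^n" by (simp add: mult_left_mono)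
    finally show ?thesis by simp
  qed
  have piece: "nuclear_on bounded_ops (2 * norm z * (1/2)^n * norm w) (\<lambda>a. ?f a (s (Suc n) - s n))" for n
  proof (rule nuclear_on_mono)
    show "nuclear_on bounded_ops (norm (s (Suc n) - s n) * norm w) (\<lambda>a. ?f a (s (Suc n) - s n))"
      by (rule nuclear_on_tensor_op_id_span) (intro complex_vector.span_diff sS)
  qed (intro mult_right_mono d norm_ge_zero)
  have geo: "(\<lambda>n. 2 * norm z * (1/2)^n * norm w) sums (2 * norm z * 2 * norm w)"
    using geometric_sums[of "1/2::real"] by (intro sums_mult sums_mult2) simp
  have "nuclear_on bounded_ops (\<Sum>n. 2 * norm z * (1/2)^n * norm w) (\<lambda>a. \<Sum>n. ?f a (s (Suc n) - s n))"
    by (rule nuclear_on_suminf[OF piece sums_summable[OF geo]])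
  moreover have "(\<Sum>n. 2 * norm z * (1/2)^n * norm w) = 4 * norm z * norm w"
    using sums_unique[OF geo] by simp
  ultimately have "nuclear_on bounded_ops (4 * norm z * norm w) (\<lambda>a. \<Sum>n. ?f a (s (Suc n) - s n))"
    by simp
  then show ?thesis
  proof (rule nuclear_on_cong)
    fix a :: "'h \<Rightarrow>\<^sub>L 'h"
    have "(\<lambda>n. ?f a (s n)) \<longlonglongrightarrow> ?f a z"
      by (intro cinner.tendsto tendsto_const blinfun.tendsto lim)
    then have "(\<lambda>n. ?f a (s (Suc n)) - ?f a (s n)) sums (?f a z - ?f a (s 0))"
      by (rule telescope_sums)
    then show "(\<Sum>n. ?f a (s (Suc n) - s n)) = ?f a z"
      by (simp add: s0 blinfun.diff_right cinner.diff_left sums_iff cinner.zero_left)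
  qed
qed

end

section \<open>The tensor square of a von Neumann algebra\<close>

lemma continuous_map_ultraweak_affine:
  assumes "y \<in> bounded_ops"
  shows "continuous_map ultraweak_topology ultraweak_topology (\<lambda>x. c *\<^sub>C x + y)"
proof -
  note S = complex_subspaceD[OF subspace_bounded_ops]
  have "continuous_map ultraweak_topology euclidean (\<lambda>x. f (c *\<^sub>C x + y))"
    if f: "f \<in> nuclear_functionals" for f
  proof -
    have l: "linear_on UNIV f" by (rule linear_on_nuclear_functional[OF f])
    obtain C where "nuclear_on UNIV C f" using nuclear_functional_nuclear_on[OF f] by blast
    then have "continuous_map ultraweak_topology euclidean f"
      using nuclear_on_continuous by fastforce
    moreover have "continuous_map euclidean euclidean (\<lambda>u. c * u + f y)"
      by (simp add: continuous_map_iff_continuous2 continuous_intros)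
    ultimately have "continuous_map ultraweak_topology euclidean ((\<lambda>u. c * u + f y) \<circ> f)"
      by (rule continuous_map_compose)
    then show ?thesis
      by (simp add: linear_on_add[OF l] linear_on_scaleC[OF l] scaleC_complex_def o_def)
  qed
  then have "continuous_map ultraweak_topology (initial_topology nuclear_functionals) (\<lambda>x. c *\<^sub>C x + y)"
    by (intro continuous_map_into_initial_topology nuclear_functionals_nonempty)
  moreover have "(\<lambda>x. c *\<^sub>C x + y) \<in> topspace ultraweak_topology \<rightarrow> bounded_ops"
    using assms S by (auto simp: topspace_ultraweak)
  ultimately show ?thesis
    by (subst (2) ultraweak_topology_def) (simp add: continuous_map_in_subtopology image_subset_iff_funcset)
qed

context tensor_product
begin

text \<open>The compression \<open>V\<^sub>y\<^sup>* T V\<^sub>x\<close>, where \<open>V\<^sub>x \<xi> = x \<otimes> \<xi>\<close>.\<close>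
definition vector_slice :: "'h \<Rightarrow> 'h \<Rightarrow> ('t \<Rightarrow>\<^sub>L 't) \<Rightarrow> ('k \<Rightarrow>\<^sub>L 'k)"
  where "vector_slice x y T = (SOME g. g \<in> bounded_ops \<and>
    (\<forall>\<xi> \<eta>. cinner (blinfun_apply g \<xi>) \<eta> = cinner (blinfun_apply T (t x \<xi>)) (t y \<eta>)))"

lemma vector_slice:
  assumes T: "T \<in> bounded_ops"
  shows vector_slice_bounded: "vector_slice x y T \<in> bounded_ops"
    and cinner_vector_slice:
      "cinner (blinfun_apply (vector_slice x y T) \<xi>) \<eta> = cinner (blinfun_apply T (t x \<xi>)) (t y \<eta>)"
proof -
  obtain g where "g \<in> bounded_ops"
    "\<And>\<xi> \<eta>. cinner (blinfun_apply g \<xi>) \<eta> = cinner (blinfun_apply T (t x \<xi>)) (t y \<eta>)"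
  proof (rule sesquilinear_form_operator[of "\<lambda>\<xi> \<eta>. cinner (blinfun_apply T (t x \<xi>)) (t y \<eta>)"
        "norm T * norm x * norm y"])
    show "cmod (cinner (blinfun_apply T (t x \<xi>)) (t y \<eta>)) \<le> norm T * norm x * norm y * norm \<xi> * norm \<eta>" for \<xi> \<eta>
      using cmod_cinner_apply_le[of T "t x \<xi>" "t y \<eta>"] by (simp add: norm_tensor mult_ac)
  qed (auto simp: add_right scale_right blinfun.add_right bounded_opsD[OF T] cinner_add_left
      cinner_add_right cinner_scaleC_left cinner_scaleC_right)
  then have "\<exists>g. g \<in> bounded_ops \<and>
    (\<forall>\<xi> \<eta>. cinner (blinfun_apply g \<xi>) \<eta> = cinner (blinfun_apply T (t x \<xi>)) (t y \<eta>))" by blast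
  from someI_ex[OF this]
  show "vector_slice x y T \<in> bounded_ops"
    "cinner (blinfun_apply (vector_slice x y T) \<xi>) \<eta> = cinner (blinfun_apply T (t x \<xi>)) (t y \<eta>)"
    unfolding vector_slice_def by blast+
qed

lemma vector_slice_eqI:
  assumes "T \<in> bounded_ops"
    and "\<And>\<xi> \<eta>. cinner (blinfun_apply g \<xi>) \<eta> = cinner (blinfun_apply T (t x \<xi>)) (t y \<eta>)"
  shows "vector_slice x y T = g"
  using assms by (intro operator_form_ext) (simp add: cinner_vector_slice)

lemma norm_vector_slice_le:
  assumes T: "T \<in> bounded_ops"
  shows "norm (vector_slice x y T) \<le> norm T * norm x * norm y"
proof (rule norm_le_form_bound)
  fix \<xi> \<eta>
  show "cmod (cinner (blinfun_apply (vector_slice x y T) \<xi>) \<eta>) \<le> norm T * norm x * norm y * norm \<xi> * norm \<eta>"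
    unfolding cinner_vector_slice[OF T]
    using cmod_cinner_apply_le[of T "t x \<xi>" "t y \<eta>"] by (simp add: norm_tensor mult_ac)
qed simp

lemma linear_vector_slice: "linear_on bounded_ops (vector_slice x y)"
  using complex_subspaceD[OF subspace_bounded_ops] unfolding linear_on_def
  by (auto intro!: vector_slice_eqI simp: blinfun.add_left cinner_add_left scaleC_blinfun.rep_eq
      cinner_scaleC_left cinner_vector_slice)

lemma vector_slice_sesquilinear:
  assumes "T \<in> bounded_ops"
  shows "vector_slice (x + x') y T = vector_slice x y T + vector_slice x' y T"
    and "vector_slice (c *\<^sub>C x) y T = c *\<^sub>C vector_slice x y T"
    and "vector_slice x (y + y') T = vector_slice x y T + vector_slice x y' T"
    and "vector_slice x (c *\<^sub>C y) T = cnj c *\<^sub>C vector_slice x y T"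
  using assms
  by (auto intro!: vector_slice_eqI simp: blinfun.add_left blinfun.add_right cinner_add_left cinner_add_right
      scaleC_blinfun.rep_eq cinner_scaleC_left cinner_scaleC_right cinner_vector_slice add_left scale_left
      bounded_opsD)

lemma vector_slice_tensor_op:
  assumes "a \<in> bounded_ops" "b \<in> bounded_ops"
  shows "vector_slice x y (tensor_op t a b) = cinner (blinfun_apply a x) y *\<^sub>C b"
  using assms
  by (intro vector_slice_eqI) (auto simp: tensor_op cinner_tensor scaleC_blinfun.rep_eq cinner_scaleC_left)

lemma pos_vector_slice:
  assumes "T \<in> bounded_ops" "pos_op T"
  shows "pos_op (vector_slice x x T)"
  using assms by (simp add: pos_op_def cinner_vector_slice)

lemma normal_vector_slice:
  assumes "A \<subseteq> bounded_ops"
  shows "normal_map A bounded_ops (vector_slice x y)"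
proof (rule normal_mapI)
  show "vector_slice x y \<in> A \<rightarrow> bounded_ops" using assms vector_slice_bounded by blast
  show "linear_on A (vector_slice x y)"
    using linear_vector_slice assms unfolding linear_on_def by blast
  fix \<xi> \<eta>
  have "nuclear_on A (norm (t x \<xi>) * norm (t y \<eta>)) (\<lambda>T. cinner (blinfun_apply T (t x \<xi>)) (t y \<eta>))"
    by (rule nuclear_on_vector)
  then have "nuclear_on A (norm (t x \<xi>) * norm (t y \<eta>)) (\<lambda>T. cinner (blinfun_apply (vector_slice x y T) \<xi>) \<eta>)"
    by (rule nuclear_on_cong) (use assms cinner_vector_slice in auto)
  then show "nuclear_on A ((norm x * norm y) * norm \<xi> * norm \<eta>) (\<lambda>T. cinner (blinfun_apply (vector_slice x y T) \<xi>) \<eta>)"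
    by (simp add: norm_tensor mult_ac)
qed simp

end

locale tensor_square = tensor_product t
  for t :: "'h::complex_hilbert_space \<Rightarrow> 'h \<Rightarrow> 't::complex_hilbert_space" +
  fixes M :: "('h \<Rightarrow>\<^sub>L 'h) set"
  assumes vN: "von_neumann_algebra M"
begin

abbreviation MM where "MM \<equiv> vn_tensor t M M"

abbreviation algebraic where
  "algebraic \<equiv> complex_vector.span {tensor_op t a b | a b. a \<in> M \<and> b \<in> M}"

lemma M_bounded: "M \<subseteq> bounded_ops"
  and M_subspace: "complex_vector.subspace M"
  and M_id: "id_blinfun \<in> M"
  using von_neumann_algebraD[OF vN] by auto

lemma M_in_bounded: "a \<in> M \<Longrightarrow> a \<in> bounded_ops"
  using M_bounded by blast

lemma algebraic_bounded: "algebraic \<subseteq> bounded_ops"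
  by (rule complex_vector.span_minimal[OF _ subspace_bounded_ops]) (auto simp: tensor_op M_in_bounded)

lemma MM_bounded: "MM \<subseteq> bounded_ops"
  using closure_of_subset_topspace[of ultraweak_topology algebraic]
  by (simp only: topspace_ultraweak vn_tensor_def)

lemma MM_in_bounded: "T \<in> MM \<Longrightarrow> T \<in> bounded_ops"
  using MM_bounded by blast

lemma algebraic_subset: "algebraic \<subseteq> MM"
  unfolding vn_tensor_def by (rule closure_of_subset) (simp add: topspace_ultraweak algebraic_bounded)

lemma tensor_op_in_MM: "a \<in> M \<Longrightarrow> b \<in> M \<Longrightarrow> tensor_op t a b \<in> MM"
  by (rule subsetD[OF algebraic_subset], rule complex_vector.span_base) blast

lemma MM_id: "id_blinfun \<in> MM"
  using tensor_op_in_MM[OF M_id M_id] by (simp add: tensor_op_id)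

text \<open>Translations and dilations are continuous, so the closure can be taken in one summand at a time.\<close>
lemma MM_subspace: "complex_vector.subspace MM"
proof -
  have alg: "c *\<^sub>C x + y \<in> algebraic" if "x \<in> algebraic" "y \<in> algebraic" for x y c
    using that by (intro complex_vector.span_add complex_vector.span_scale)
  have 1: "c *\<^sub>C x + y \<in> MM" if "x \<in> MM" "y \<in> algebraic" for x y c
  proof -
    have "y \<in> bounded_ops" using that algebraic_bounded by blast
    then have "(\<lambda>x. c *\<^sub>C x + y) ` MM \<subseteq> ultraweak_topology closure_of ((\<lambda>x. c *\<^sub>C x + y) ` algebraic)"
      unfolding vn_tensor_def by (intro continuous_map_image_closure_subset continuous_map_ultraweak_affine)
    also have "\<dots> \<subseteq> MM"
      unfolding vn_tensor_def using alg that by (intro closure_of_mono) blast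
    finally show ?thesis using that by blast
  qed
  have 2: "c *\<^sub>C x + y \<in> MM" if "x \<in> MM" "y \<in> MM" for x y c
  proof -
    have b: "c *\<^sub>C x \<in> bounded_ops" using that MM_bounded complex_subspaceD(3)[OF subspace_bounded_ops] by blast
    have "(\<lambda>y. 1 *\<^sub>C y + c *\<^sub>C x) ` MM \<subseteq> ultraweak_topology closure_of ((\<lambda>y. 1 *\<^sub>C y + c *\<^sub>C x) ` algebraic)"
      using continuous_map_image_closure_subset[OF continuous_map_ultraweak_affine[OF b]]
      unfolding vn_tensor_def .
    also have "\<dots> \<subseteq> MM"
      using 1[OF that(1)] by (intro closure_of_minimal) (auto simp: scaleC_one add.commute vn_tensor_def)
    finally have "1 *\<^sub>C y + c *\<^sub>C x \<in> MM" using that by blast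
    then show ?thesis by (simp add: scaleC_one add.commute)
  qed
  have 0: "0 \<in> MM" by (rule subsetD[OF algebraic_subset complex_vector.span_zero])
  show ?thesis unfolding complex_vector.subspace_def
  proof (intro conjI ballI allI 0)
    show "x + y \<in> MM" if "x \<in> MM" "y \<in> MM" for x y
      using 2[OF that, of 1] by (simp add: scaleC_one)
    show "c *\<^sub>C x \<in> MM" if "x \<in> MM" for x c
      using 2[OF that 0, of c] by simp
  qed
qed

lemma algebraic_dense: "subtopology ultraweak_topology MM closure_of algebraic = MM"
  unfolding closure_of_subtopology using algebraic_subset
  by (simp add: Int_absorb1 vn_tensor_def)

lemma normal_functional_eqI:
  assumes f: "normal_functional MM f" and g: "normal_functional MM g"
    and eq: "\<And>a b. a \<in> M \<Longrightarrow> b \<in> M \<Longrightarrow> f (tensor_op t a b) = g (tensor_op t a b)"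
    and T: "T \<in> MM"
  shows "f T = g T"
proof -
  have lf: "linear_on MM f" and lg: "linear_on MM g"
    and cf: "continuous_map (subtopology ultraweak_topology MM) euclidean f"
    and cg: "continuous_map (subtopology ultraweak_topology MM) euclidean g"
    using f g by (auto simp: normal_functional_def)
  have 0: "0 \<in> MM" using MM_subspace by (rule complex_subspaceD)
  have "f z = g z \<and> z \<in> MM" if "z \<in> algebraic" for z
    using that
  proof (induction rule: complex_vector.span_induct_alt)
    case base
    have "f (0 *\<^sub>C 0) = g (0 *\<^sub>C 0)"
      unfolding linear_on_scaleC[OF lf 0] linear_on_scaleC[OF lg 0] by (simp add: scaleC_complex_def)
    then show ?case using 0 by simp
  next
    case (step c x y)
    then have x: "x \<in> MM" "f x = g x" using tensor_op_in_MM eq by auto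
    then show ?case
      using step complex_subspaceD[OF MM_subspace]
      by (simp add: linear_on_add[OF lf] linear_on_add[OF lg] linear_on_scaleC[OF lf] linear_on_scaleC[OF lg])
  qed
  then have agree: "f z = g z" if "z \<in> algebraic" for z using that by blast
  show ?thesis
  proof (rule forall_in_closure_of_eq[OF _ _ cf cg agree])
    show "T \<in> subtopology ultraweak_topology MM closure_of algebraic"
      unfolding algebraic_dense by (rule T)
  qed simp_all
qed

lemma normal_map_into_M:
  assumes G: "normal_map MM bounded_ops G" and gen: "\<And>a b. a \<in> M \<Longrightarrow> b \<in> M \<Longrightarrow> G (tensor_op t a b) \<in> M"
  shows "G \<in> MM \<rightarrow> M"
proof -
  have lin: "linear_on MM G"
    and cont: "continuous_map (subtopology ultraweak_topology MM) (subtopology ultraweak_topology bounded_ops) G"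
    using G by (auto simp: normal_map_def)
  have 0: "0 \<in> MM" using MM_subspace by (rule complex_subspaceD)
  note S = complex_subspaceD[OF M_subspace]
  have "G z \<in> M \<and> z \<in> MM" if "z \<in> algebraic" for z
    using that
  proof (induction rule: complex_vector.span_induct_alt)
    case base
    have "G (0 *\<^sub>C 0) = 0"
      unfolding linear_on_scaleC[OF lin 0] by simp
    then show ?case using 0 S by simp
  next
    case (step c x y)
    then have x: "x \<in> MM" "G x \<in> M" using tensor_op_in_MM gen by auto
    then show ?case
      using step complex_subspaceD[OF MM_subspace] S
      by (simp add: linear_on_add[OF lin] linear_on_scaleC[OF lin])
  qed
  then have "G ` algebraic \<subseteq> M" by blast
  then have "ultraweak_topology closure_of G ` algebraic \<subseteq> M"
    by (rule closure_of_minimal) (rule von_neumann_algebra_ultraweak_closed[OF vN])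
  moreover have "continuous_map (subtopology ultraweak_topology MM) ultraweak_topology G"
    using cont by (rule continuous_map_into_fulltopology)
  from continuous_map_image_closure_subset[OF this, of algebraic]
  have "G ` MM \<subseteq> ultraweak_topology closure_of G ` algebraic" unfolding algebraic_dense .
  ultimately show ?thesis by blast
qed

lemma vector_slice_in_M: "T \<in> MM \<Longrightarrow> vector_slice x y T \<in> M"
proof -
  have "vector_slice x y \<in> MM \<rightarrow> M"
  proof (rule normal_map_into_M[OF normal_vector_slice[OF MM_bounded]])
    show "vector_slice x y (tensor_op t a b) \<in> M" if "a \<in> M" "b \<in> M" for a b
      using that by (simp add: vector_slice_tensor_op M_in_bounded complex_subspaceD(3)[OF M_subspace])
  qed
  then show "T \<in> MM \<Longrightarrow> vector_slice x y T \<in> M" by blast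
qed

end

section \<open>Normal states and slice maps\<close>

lemma normal_statesD:
  assumes "\<phi> \<in> normal_states A"
  shows "normal_functional A \<phi>" "linear_on A \<phi>" "a \<in> A \<Longrightarrow> pos_op a \<Longrightarrow> \<phi> a \<in> \<real>\<^sub>\<ge>\<^sub>0" "\<phi> id_blinfun = 1"
  using assms by (auto simp: normal_states_def normal_functional_def)

lemma predual_normal_state:
  assumes T: "normal_map A B T" "T id_blinfun = id_blinfun" "\<And>a. a \<in> A \<Longrightarrow> pos_op a \<Longrightarrow> pos_op (T a)"
    and \<phi>: "\<phi> \<in> normal_states B"
  shows "predual T \<phi> \<in> normal_states A"
proof -
  have "T \<in> A \<rightarrow> B" using T(1) by (simp add: normal_map_def)
  then show ?thesis
    using T \<phi> normal_functional_comp[OF T(1), of \<phi>]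
    by (auto simp: normal_states_def predual_def o_def Pi_iff)
qed

text \<open>The quadratic form says that \<open>a\<close> is self-adjoint with \<open>a \<le> K\<close>, so \<open>\<phi>\<close> is nonnegative on \<open>K - a\<close>.\<close>
lemma state_bound_self_adjoint:
  assumes A: "complex_vector.subspace A" "id_blinfun \<in> A" and \<phi>: "\<phi> \<in> normal_states A" and a: "a \<in> A"
    and r: "\<And>x. cinner (blinfun_apply a x) x = complex_of_real (r x)" "\<And>x. r x \<le> K * (norm x)\<^sup>2"
  shows "\<phi> a \<in> \<real>" "Re (\<phi> a) \<le> K"
proof -
  let ?b = "complex_of_real K *\<^sub>C id_blinfun - a"
  have Kid: "complex_of_real K *\<^sub>C id_blinfun \<in> A" using A by (metis complex_subspaceD(3))
  have "cinner (blinfun_apply ?b x) x = complex_of_real (K * (norm x)\<^sup>2 - r x)" for x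
    by (simp add: blinfun.diff_left cinner.diff_left scaleC_blinfun.rep_eq cinner_scaleC_left r cinner_self)
  then have "pos_op ?b" using r(2) by (simp add: pos_op_def complex_nonneg_Reals_iff)
  then have "\<phi> ?b \<in> \<real>\<^sub>\<ge>\<^sub>0"
    using complex_subspace_diff[OF A(1) Kid a] normal_statesD(3)[OF \<phi>] by blast
  moreover have "\<phi> ?b = complex_of_real K - \<phi> a"
    using linear_on_diff[OF A(1) normal_statesD(2)[OF \<phi>] Kid a]
      linear_on_scaleC[OF normal_statesD(2)[OF \<phi>] A(2)] normal_statesD(4)[OF \<phi>] by (simp add: scaleC_complex_def)
  ultimately show "\<phi> a \<in> \<real>" "Re (\<phi> a) \<le> K" by (auto simp: complex_nonneg_Reals_iff complex_is_Real_iff)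
qed

text \<open>After multiplying \<open>b\<close> by a phase, \<open>\<phi> b \<ge> 0\<close>; it then equals the value of \<open>\<phi>\<close> at the self-adjoint
  part of \<open>b\<close>, which is at most \<open>\<parallel>b\<parallel>\<close> as an operator.\<close>
lemma state_bound:
  assumes vN: "von_neumann_algebra M" and \<phi>: "\<phi> \<in> normal_states M" and b: "b \<in> M"
  shows "cmod (\<phi> b) \<le> norm b"
proof (cases "\<phi> b = 0")
  case False
  note M = von_neumann_algebraD[OF vN]
  note S = complex_subspaceD[OF M(2)]
  have lin: "linear_on M \<phi>" by (rule normal_statesD[OF \<phi>])
  define u where "u = cnj (\<phi> b) / cmod (\<phi> b)"
  have cu: "cmod u = 1" using False by (simp add: u_def norm_divide)
  define c where "c = u *\<^sub>C b"
  have cM: "c \<in> M" unfolding c_def using S(3) b by blast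
  have cB: "c \<in> bounded_ops" using cM M(1) by blast
  have "\<phi> c = u * \<phi> b" using linear_on_scaleC[OF lin b] by (simp add: c_def scaleC_complex_def)
  also have "\<dots> = complex_of_real (cmod (\<phi> b))"
    using False by (simp add: u_def complex_norm_square[symmetric] mult.commute power2_eq_square)
  finally have \<phi>c: "\<phi> c = complex_of_real (cmod (\<phi> b))" .
  have qc: "cmod (cinner (blinfun_apply c x) x) \<le> norm b * (norm x)\<^sup>2" for x
    using cmod_cinner_apply_le[of b x x] cu
    by (simp add: c_def scaleC_blinfun.rep_eq cinner_scaleC_left norm_mult power2_eq_square mult.assoc)
  have adj: "cinner (blinfun_apply (adj c) x) x = cnj (cinner (blinfun_apply c x) x)" for x
    using cinner_adj[OF cB, of x x] by (metis cinner_commute)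
  define h where "h = (1/2) *\<^sub>C (c + adj c)"
  define k where "k = (- \<i>/2) *\<^sub>C (c - adj c)"
  have aM: "adj c \<in> M" using M(4) cM by blast
  have hM: "h \<in> M" and kM: "k \<in> M"
    unfolding h_def k_def using S(2,3) complex_subspace_diff[OF M(2)] cM aM by blast+
  have hx: "cinner (blinfun_apply h x) x = complex_of_real (Re (cinner (blinfun_apply c x) x))" for x
    by (simp add: h_def scaleC_blinfun.rep_eq blinfun.add_left cinner_scaleC_left cinner_add_left adj complex_add_cnj)
  have hb: "Re (cinner (blinfun_apply c x) x) \<le> norm b * (norm x)\<^sup>2" for x
    using qc[of x] complex_Re_le_cmod order_trans by blast
  note h = state_bound_self_adjoint[OF M(2,3) \<phi> hM hx hb]
  have k: "\<phi> k \<in> \<real>"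
  proof (rule state_bound_self_adjoint[OF M(2,3) \<phi> kM])
    show "cinner (blinfun_apply k x) x = complex_of_real (Im (cinner (blinfun_apply c x) x))" for x
      by (simp add: k_def scaleC_blinfun.rep_eq blinfun.diff_left cinner_scaleC_left cinner.diff_left adj complex_diff_cnj
          blinfun.minus_left cinner.minus_left mult.left_commute[of \<i>])
    show "Im (cinner (blinfun_apply c x) x) \<le> norm b * (norm x)\<^sup>2" for x
      using qc[of x] abs_Im_le_cmod[of "cinner (blinfun_apply c x) x"] by linarith
  qed
  have "c = h + \<i> *\<^sub>C k"
  proof (rule blinfun_eqI)
    fix x
    let ?p = "blinfun_apply c x" and ?q = "blinfun_apply (adj c) x"
    have "blinfun_apply (h + \<i> *\<^sub>C k) x = ((1/2) *\<^sub>C ?p + (1/2) *\<^sub>C ?q) + ((1/2) *\<^sub>C ?p - (1/2) *\<^sub>C ?q)"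
      by (simp add: h_def k_def blinfun.add_left blinfun.diff_left scaleC_blinfun.rep_eq scaleC_add_right
          complex_vector.scale_right_diff_distrib scaleC_scaleC)
    also have "\<dots> = (1/2) *\<^sub>C ?p + (1/2) *\<^sub>C ?p" by simp
    also have "\<dots> = ?p" by (simp flip: scaleC_add_left add: scaleC_one)
    finally show "?p = blinfun_apply (h + \<i> *\<^sub>C k) x" by simp
  qed
  then have "\<phi> c = \<phi> h + \<i> * \<phi> k"
    using linear_on_add[OF lin hM S(3)[OF kM]] linear_on_scaleC[OF lin kM] by (simp add: scaleC_complex_def)
  then have "Re (\<phi> c) = Re (\<phi> h)" using k by (simp add: complex_is_Real_iff)
  then show ?thesis using \<phi>c h by simp
qed simp

context tensor_square
begin

text \<open>For fixed \<open>T\<close> the form \<open>\<omega>(G\<^sub>x\<^sub>,\<^sub>y(T))\<close> in \<open>x\<close>, \<open>y\<close> is bounded and defines \<open>E T\<close>. Expanding \<open>\<omega>\<close> as a series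
  \<open>\<Sum>n. \<langle>\<cdot> \<xi>\<^sub>n, \<eta>\<^sub>n\<rangle>\<close> turns its coefficients into \<open>\<Sum>n. \<langle>T (x \<otimes> \<xi>\<^sub>n), y \<otimes> \<eta>\<^sub>n\<rangle>\<close>, whence ultraweak continuity in \<open>T\<close>.\<close>
lemma slice_exists:
  assumes \<omega>: "normal_functional M \<omega>"
  shows "\<exists>E. normal_map MM M E \<and>
    (\<forall>T\<in>MM. \<forall>x y. cinner (blinfun_apply (E T) x) y = \<omega> (vector_slice x y T)) \<and>
    (\<forall>a\<in>M. \<forall>b\<in>M. E (tensor_op t a b) = \<omega> b *\<^sub>C a)"
proof -
  have lin: "linear_on M \<omega>" using \<omega> by (simp add: normal_functional_def)
  note [simp] = linear_on_add[OF lin] linear_on_scaleC[OF lin] vector_slice_in_M scaleC_complex_def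
    complex_subspaceD(3)[OF M_subspace]
  obtain C where C: "nuclear_on M C \<omega>" by (rule normal_functional_nuclear[OF M_bounded M_subspace \<omega>])
  have C0: "C \<ge> 0" by (rule nuclear_on_nonneg[OF C])
  have "\<exists>e. e \<in> bounded_ops \<and> (\<forall>x y. cinner (blinfun_apply e x) y = \<omega> (vector_slice x y T))" if T: "T \<in> MM" for T
  proof -
    note [simp] = vector_slice_sesquilinear[OF MM_in_bounded[OF T]]
    have bound: "cmod (\<omega> (vector_slice x y T)) \<le> C * norm T * norm x * norm y" for x y
    proof -
      have "cmod (\<omega> (vector_slice x y T)) \<le> C * norm (vector_slice x y T)"
        by (rule nuclear_on_bound[OF C vector_slice_in_M[OF T]])
      also have "\<dots> \<le> C * (norm T * norm x * norm y)"
        by (intro mult_left_mono norm_vector_slice_le C0 MM_in_bounded[OF T])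
      finally show ?thesis by (simp add: mult_ac)
    qed
    obtain e where "e \<in> bounded_ops" "\<And>x y. cinner (blinfun_apply e x) y = \<omega> (vector_slice x y T)"
      by (rule sesquilinear_form_operator[of "\<lambda>x y. \<omega> (vector_slice x y T)" "C * norm T"])
        (use bound T C0 in auto)
    then show ?thesis by blast
  qed
  then obtain E where EB: "\<And>T. T \<in> MM \<Longrightarrow> E T \<in> bounded_ops"
    and E: "\<And>T x y. T \<in> MM \<Longrightarrow> cinner (blinfun_apply (E T) x) y = \<omega> (vector_slice x y T)"
    by metis
  have El: "linear_on MM E"
    unfolding linear_on_def
  proof (intro conjI ballI allI)
    note S = complex_subspaceD[OF MM_subspace]
    show "E (T + T') = E T + E T'" if "T \<in> MM" "T' \<in> MM" for T T'
      using that by (intro operator_form_ext)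
        (simp add: E S blinfun.add_left cinner_add_left linear_on_add[OF linear_vector_slice] MM_in_bounded)
    show "E (c *\<^sub>C T) = c *\<^sub>C E T" if "T \<in> MM" for c T
      using that by (intro operator_form_ext)
        (simp add: E S scaleC_blinfun.rep_eq cinner_scaleC_left linear_on_scaleC[OF linear_vector_slice] MM_in_bounded)
  qed
  have Et: "E (tensor_op t a b) = \<omega> b *\<^sub>C a" if "a \<in> M" "b \<in> M" for a b
    using that by (intro operator_form_ext)
      (simp add: E tensor_op_in_MM vector_slice_tensor_op M_in_bounded scaleC_blinfun.rep_eq cinner_scaleC_left)
  have nuc: "nuclear_on MM (C * norm x * norm y) (\<lambda>T. cinner (blinfun_apply (E T) x) y)" for x y
    using C
  proof (rule nuclear_onE)
    fix \<xi> \<eta>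
    assume *: "summable (\<lambda>n. (norm (\<xi> n))\<^sup>2)" "(\<Sum>n. (norm (\<xi> n))\<^sup>2) \<le> C"
      "summable (\<lambda>n. (norm (\<eta> n))\<^sup>2)" "(\<Sum>n. (norm (\<eta> n))\<^sup>2) \<le> C"
      and w: "\<And>a. a \<in> M \<Longrightarrow> \<omega> a = (\<Sum>n. cinner (blinfun_apply a (\<xi> n)) (\<eta> n))"
    have sum: "summable (\<lambda>n. (norm (t x (\<zeta> n)))\<^sup>2)" "(\<Sum>n. (norm (t x (\<zeta> n)))\<^sup>2) \<le> (norm x * sqrt C)\<^sup>2"
      if "summable (\<lambda>n. (norm (\<zeta> n))\<^sup>2)" "(\<Sum>n. (norm (\<zeta> n))\<^sup>2) \<le> C" for x and \<zeta> :: "nat \<Rightarrow> 'h"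
      using that C0 by (simp_all add: norm_tensor power_mult_distrib summable_mult suminf_mult mult_left_mono)
    have "nuclear_on MM ((norm x * sqrt C) * (norm y * sqrt C)) (\<lambda>T. cinner (blinfun_apply (E T) x) y)"
    proof (rule nuclear_onI[OF sum(1)[OF *(1,2)] sum(2)[OF *(1,2)] _ sum(1)[OF *(3,4)] sum(2)[OF *(3,4)]])
      show "cinner (blinfun_apply (E T) x) y = (\<Sum>n. cinner (blinfun_apply T (t x (\<xi> n))) (t y (\<eta> n)))"
        if "T \<in> MM" for T
        using that by (simp add: E w cinner_vector_slice MM_in_bounded)
    qed (use C0 in auto)
    moreover have "(norm x * sqrt C) * (norm y * sqrt C) = C * norm x * norm y"
      using C0 by (simp add: mult_ac flip: real_sqrt_mult) 
    ultimately show ?thesis by simp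
  qed
  have "normal_map MM bounded_ops E"
    by (rule normal_mapI[OF _ _ El nuc]) (use EB in auto)
  then have "E \<in> MM \<rightarrow> M"
    by (rule normal_map_into_M) (simp add: Et)
  then have "normal_map MM M E"
    by (rule normal_mapI[OF _ M_bounded El nuc])
  then show ?thesis using E Et by blast
qed

lemma slice_normal_map:
  assumes "normal_functional M \<omega>"
  shows "normal_map MM M (slice t M \<omega>)"
    and "a \<in> M \<Longrightarrow> b \<in> M \<Longrightarrow> slice t M \<omega> (tensor_op t a b) = \<omega> b *\<^sub>C a"
proof -
  have "\<exists>E. normal_map MM M E \<and> (\<forall>a\<in>M. \<forall>b\<in>M. E (tensor_op t a b) = \<omega> b *\<^sub>C a)"
    using slice_exists[OF assms] by blast
  from someI_ex[OF this]
  show "normal_map MM M (slice t M \<omega>)"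
    "a \<in> M \<Longrightarrow> b \<in> M \<Longrightarrow> slice t M \<omega> (tensor_op t a b) = \<omega> b *\<^sub>C a"
    unfolding slice_def by blast+
qed

lemma normal_vector_functional: "normal_functional A (\<lambda>a. cinner (blinfun_apply a x) y)"
  by (rule normal_functionalI[OF _ nuclear_on_vector])
    (simp add: linear_on_def blinfun.add_left cinner_add_left scaleC_blinfun.rep_eq cinner_scaleC_left scaleC_complex_def)

text \<open>The two sides are normal functionals of \<open>T\<close> that agree on simple tensors, so this holds for
  whichever slice map is chosen.\<close>
lemma cinner_slice:
  assumes \<omega>: "normal_functional M \<omega>" and T: "T \<in> MM"
  shows "cinner (blinfun_apply (slice t M \<omega> T) x) y = \<omega> (vector_slice x y T)"
proof -
  obtain E where E: "normal_map MM M E"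
    "\<And>T x y. T \<in> MM \<Longrightarrow> cinner (blinfun_apply (E T) x) y = \<omega> (vector_slice x y T)"
    "\<And>a b. a \<in> M \<Longrightarrow> b \<in> M \<Longrightarrow> E (tensor_op t a b) = \<omega> b *\<^sub>C a"
    using slice_exists[OF \<omega>] by metis
  have "cinner (blinfun_apply (slice t M \<omega> T) x) y = cinner (blinfun_apply (E T) x) y"
    using normal_functional_comp[OF slice_normal_map(1)[OF \<omega>] normal_vector_functional]
      normal_functional_comp[OF E(1) normal_vector_functional] _ T
    by (rule normal_functional_eqI) (simp add: E(3) slice_normal_map(2)[OF \<omega>])
  then show ?thesis using E(2)[OF T] by simp
qed

lemma slice_in_M: "normal_functional M \<omega> \<Longrightarrow> T \<in> MM \<Longrightarrow> slice t M \<omega> T \<in> M"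
  using slice_normal_map(1) by (auto simp: normal_map_def)

lemma state_slice:
  assumes \<omega>: "\<omega> \<in> normal_states M"
  shows slice_tensor_id: "a \<in> M \<Longrightarrow> slice t M \<omega> (tensor_op t a id_blinfun) = a"
    and slice_id: "slice t M \<omega> id_blinfun = id_blinfun"
    and pos_slice: "T \<in> MM \<Longrightarrow> pos_op T \<Longrightarrow> pos_op (slice t M \<omega> T)"
    and norm_slice_le: "T \<in> MM \<Longrightarrow> norm (slice t M \<omega> T) \<le> norm T"
proof -
  note n = normal_statesD(1)[OF \<omega>]
  show 1: "slice t M \<omega> (tensor_op t a id_blinfun) = a" if "a \<in> M" for a
    using slice_normal_map(2)[OF n that M_id] normal_statesD(4)[OF \<omega>] by (simp add: scaleC_one)
  show "slice t M \<omega> id_blinfun = id_blinfun"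
    using 1[OF M_id] by (simp add: tensor_op_id)
  show "pos_op (slice t M \<omega> T)" if "T \<in> MM" "pos_op T"
    using pos_vector_slice[OF MM_in_bounded[OF that(1)] that(2)] vector_slice_in_M[OF that(1)]
      normal_statesD(3)[OF \<omega>] by (simp add: pos_op_def[of "slice t M \<omega> T"] cinner_slice[OF n that(1)])
  show "norm (slice t M \<omega> T) \<le> norm T" if T: "T \<in> MM"
  proof (rule norm_le_form_bound)
    show "cmod (cinner (blinfun_apply (slice t M \<omega> T) x) y) \<le> norm T * norm x * norm y" for x y
      unfolding cinner_slice[OF n T]
      using state_bound[OF vN \<omega> vector_slice_in_M[OF T]] norm_vector_slice_le[OF MM_in_bounded[OF T]]
        order_trans by blast
  qed simp
qed

lemma predual_slice_state:
  assumes "\<omega> \<in> normal_states M" "\<phi> \<in> normal_states M"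
  shows "predual (slice t M \<omega>) \<phi> \<in> normal_states MM"
  using assms by (intro predual_normal_state[of MM M] slice_normal_map normal_statesD slice_id pos_slice)

lemma normal_tensor_op_id: "normal_map M MM (\<lambda>a. tensor_op t a id_blinfun)"
proof (rule normal_mapI)
  show "(\<lambda>a. tensor_op t a id_blinfun) \<in> M \<rightarrow> MM" using tensor_op_in_MM[OF _ M_id] by blast
  show "MM \<subseteq> bounded_ops" by (rule MM_bounded)
  show "linear_on M (\<lambda>a. tensor_op t a id_blinfun)"
    using linear_tensor_op_id M_bounded unfolding linear_on_def by blast
  show "nuclear_on M (4 * norm \<xi> * norm \<eta>) (\<lambda>a. cinner (blinfun_apply (tensor_op t a id_blinfun) \<xi>) \<eta>)" for \<xi> \<eta>
    using nuclear_on_tensor_op_id[of \<xi> \<eta>] M_bounded unfolding nuclear_on_def by (meson subsetD)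
qed

lemma predual_tensor_id_state:
  assumes "\<phi> \<in> normal_states MM"
  shows "predual (\<lambda>a. tensor_op t a id_blinfun) \<phi> \<in> normal_states M"
  by (rule predual_normal_state[OF normal_tensor_op_id tensor_op_id _ assms])
    (use pos_tensor_op_id M_in_bounded in blast)

text \<open>The product functional is \<open>\<omega> \<circ> E\<^sub>\<psi>\<close>, by uniqueness.\<close>
lemma product_functional_state:
  assumes \<omega>: "\<omega> \<in> normal_states M" and \<psi>: "\<psi> \<in> normal_states M"
  shows "product_functional t M \<omega> \<psi> \<in> normal_states MM"
proof -
  let ?f = "predual (slice t M \<psi>) \<omega>" and ?p = "product_functional t M \<omega> \<psi>"
  have f: "?f \<in> normal_states MM" by (rule predual_slice_state[OF \<psi> \<omega>])
  have ft: "?f (tensor_op t a b) = \<omega> a * \<psi> b" if "a \<in> M" "b \<in> M" for a b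
    using slice_normal_map(2)[OF normal_statesD(1)[OF \<psi>] that] linear_on_scaleC[OF normal_statesD(2)[OF \<omega>] that(1)]
    by (simp add: predual_def scaleC_complex_def mult.commute)
  have "\<exists>f. normal_functional MM f \<and> (\<forall>a\<in>M. \<forall>b\<in>M. f (tensor_op t a b) = \<omega> a * \<psi> b)"
    using normal_statesD(1)[OF f] ft by blast
  from someI_ex[OF this]
  have p: "normal_functional MM ?p" "\<And>a b. a \<in> M \<Longrightarrow> b \<in> M \<Longrightarrow> ?p (tensor_op t a b) = \<omega> a * \<psi> b"
    unfolding product_functional_def by blast+
  have "?p T = ?f T" if "T \<in> MM" for T
    using p(1) normal_statesD(1)[OF f] _ that by (rule normal_functional_eqI) (simp add: p(2) ft)
  then show ?thesis using f p(1) MM_id by (simp add: normal_states_def)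
qed

end

section \<open>Ergodicity\<close>

lemma functional_norm_mono:
  assumes "0 \<in> A" and bdd: "bdd_above ((\<lambda>y. cmod (g y)) ` {y \<in> B. norm y \<le> 1})"
    and le: "\<And>x. x \<in> A \<Longrightarrow> norm x \<le> 1 \<Longrightarrow> \<exists>y\<in>B. norm y \<le> 1 \<and> f x = g y"
  shows "functional_norm A f \<le> functional_norm B g"
  unfolding functional_norm_def
proof (rule cSUP_least)
  show "{x \<in> A. norm x \<le> 1} \<noteq> {}" using assms(1) by force
  fix x assume "x \<in> {x \<in> A. norm x \<le> 1}"
  then obtain y where "y \<in> {y \<in> B. norm y \<le> 1}" "f x = g y" using le by blast
  then show "cmod (f x) \<le> (SUP y\<in>{y \<in> B. norm y \<le> 1}. cmod (g y))"
    using cSUP_upper[OF _ bdd] by simp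
qed

lemma normal_difference_bounded:
  assumes A: "A \<subseteq> bounded_ops" "complex_vector.subspace A"
    and f: "normal_functional A f" and g: "normal_functional A g"
  shows "bdd_above ((\<lambda>a. cmod ((f - g) a)) ` {a \<in> A. norm a \<le> 1})"
proof -
  obtain C where C: "nuclear_on A C f" by (rule normal_functional_nuclear[OF A f])
  obtain D where D: "nuclear_on A D g" by (rule normal_functional_nuclear[OF A g])
  have "cmod ((f - g) a) \<le> C + D" if "a \<in> A" "norm a \<le> 1" for a
  proof -
    have "cmod (f a) \<le> C * 1" "cmod (g a) \<le> D * 1"
      using nuclear_on_bound[OF C that(1)] nuclear_on_bound[OF D that(1)]
        mult_left_mono[OF that(2) nuclear_on_nonneg[OF C]] mult_left_mono[OF that(2) nuclear_on_nonneg[OF D]]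
      by linarith+
    then show ?thesis using norm_triangle_ineq4[of "f a" "g a"] by simp
  qed
  then show ?thesis by (intro bdd_aboveI2) blast
qed

lemma functional_norm_nonneg:
  assumes "0 \<in> A" "bdd_above ((\<lambda>a. cmod (f a)) ` {a \<in> A. norm a \<le> 1})"
  shows "0 \<le> functional_norm A f"
proof -
  have "cmod (f 0) \<le> functional_norm A f"
    unfolding functional_norm_def by (rule cSUP_upper[OF _ assms(2)]) (use assms(1) in simp)
  then show ?thesis using norm_ge_zero order_trans by blast
qed

text \<open>All norm comparisons below have this form: the functionals on \<open>A\<close> factor through functionals on \<open>B\<close>
  along a map \<open>j\<close> that does not increase norms. Normality bounds the suprema that
  define the norms. The factorisation is required for \<open>u \<ge> r\<close> because the maps of the
  process are controlled only from one time unit after the initial time.\<close>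
lemma functional_norm_tendsto_zero:
  assumes A: "A \<subseteq> bounded_ops" "complex_vector.subspace A"
    and B: "B \<subseteq> bounded_ops" "complex_vector.subspace B"
    and f: "\<And>u. u \<ge> r \<Longrightarrow> normal_functional A (f u)" "\<And>u. u \<ge> r \<Longrightarrow> normal_functional A (f' u)"
    and g: "\<And>u. u \<ge> r \<Longrightarrow> normal_functional B (g u)" "\<And>u. u \<ge> r \<Longrightarrow> normal_functional B (g' u)"
    and factor: "\<And>u x. u \<ge> r \<Longrightarrow> x \<in> A \<Longrightarrow> j u x \<in> B \<and> norm (j u x) \<le> norm x \<and> f u x = g u (j u x) \<and> f' u x = g' u (j u x)"
    and lim: "((\<lambda>u. functional_norm B (g u - g' u)) \<longlongrightarrow> 0) (at_top :: real filter)"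
  shows "((\<lambda>u. functional_norm A (f u - f' u)) \<longlongrightarrow> 0) at_top"
proof (rule tendsto_sandwich[OF _ _ tendsto_const lim])
  have 0: "0 \<in> A" using A(2) by (rule complex_subspaceD)
  show "\<forall>\<^sub>F u in at_top. 0 \<le> functional_norm A (f u - f' u)"
    using eventually_ge_at_top[of r]
    by eventually_elim (intro functional_norm_nonneg 0 normal_difference_bounded A f)
  show "\<forall>\<^sub>F u in at_top. functional_norm A (f u - f' u) \<le> functional_norm B (g u - g' u)"
    using eventually_ge_at_top[of r]
  proof eventually_elim
    case (elim u)
    show ?case
    proof (rule functional_norm_mono[OF 0 normal_difference_bounded[OF B g(1)[OF elim] g(2)[OF elim]]])
      fix x assume x: "x \<in> A" "norm x \<le> 1"
      with factor[OF elim x(1)] show "\<exists>y\<in>B. norm y \<le> 1 \<and> (f u - f' u) x = (g u - g' u) y"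
        by (intro bexI[of _ "j u x"]) auto
    qed
  qed
qed

lemma completely_positive_pos:
  assumes "completely_positive M T" "a \<in> M" "pos_op a"
  shows "pos_op (T a)"
proof -
  have "pos_matrix 1 (\<lambda>_ _. a)" using assms(3) by (simp add: pos_matrix_def pos_op_def)
  then have "pos_matrix 1 (\<lambda>_ _. T a)"
    using assms(1,2) unfolding completely_positive_def by (elim allE[of _ 1] allE[of _ "\<lambda>_ _. a"]) auto
  then have "cinner (blinfun_apply (T a) (h 0)) (h 0) \<in> \<real>\<^sub>\<ge>\<^sub>0" for h :: "nat \<Rightarrow> 'b"
    by (simp add: pos_matrix_def)
  from this[of "\<lambda>_. x" for x] show ?thesis by (simp add: pos_op_def)
qed

locale quadratic_process = tensor_square t M
  for t :: "'h::complex_hilbert_space \<Rightarrow> 'h \<Rightarrow> 't::complex_hilbert_space" and M :: "('h \<Rightarrow>\<^sub>L 'h) set" +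
  fixes P :: "real \<Rightarrow> real \<Rightarrow> ('h \<Rightarrow>\<^sub>L 'h) \<Rightarrow> ('t \<Rightarrow>\<^sub>L 't)" and \<omega>0 :: "('h \<Rightarrow>\<^sub>L 'h) \<Rightarrow> complex"
  assumes process: "qqsp_A t M P \<omega>0"
begin

abbreviation \<omega> where "\<omega> s \<equiv> omega t M P \<omega>0 s"
abbreviation E where "E s \<equiv> slice t M (\<omega> s)"
abbreviation amp where "amp a \<equiv> tensor_op t a id_blinfun"
abbreviation Q where "Q \<equiv> Q_process t M P \<omega>0"
abbreviation H where "H \<equiv> H_process t M P \<omega>0"
abbreviation Z where "Z \<equiv> Z_process t M P \<omega>0"
abbreviation initial_times :: "real set" where "initial_times \<equiv> {0} \<union> {1..}"

lemma P_map:
  assumes "0 \<le> s" "s + 1 \<le> u"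
  shows "normal_map M MM (P s u)" "P s u id_blinfun = id_blinfun" "completely_positive M (P s u)"
  using process assms unfolding qqsp_A_def by auto

lemma P_in: "0 \<le> s \<Longrightarrow> s + 1 \<le> u \<Longrightarrow> x \<in> M \<Longrightarrow> P s u x \<in> MM"
  using P_map(1) by (auto simp: normal_map_def)

lemma P_evolution:
  assumes "0 \<le> s" "s + 1 \<le> \<tau>" "\<tau> + 1 \<le> u" "x \<in> M"
  shows "P s u x = P s \<tau> (Q \<tau> u x)"
  using process assms unfolding qqsp_A_def Q_process_def by auto

lemma predual_P_state:
  assumes "0 \<le> s" "s + 1 \<le> u" "\<phi> \<in> normal_states MM"
  shows "predual (P s u) \<phi> \<in> normal_states M"
  using P_map[OF assms(1,2)] assms(3) completely_positive_pos by (intro predual_normal_state) auto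

lemma \<omega>_state:
  assumes "s \<in> initial_times"
  shows "\<omega> s \<in> normal_states M"
proof (cases "s = 0")
  case True
  then show ?thesis using process by (simp add: omega_def qqsp_A_def)
next
  case False
  have \<omega>0: "\<omega>0 \<in> normal_states M" using process by (simp add: qqsp_A_def)
  have "\<omega> s = predual (P 0 s) (product_functional t M \<omega>0 \<omega>0)"
    using False by (simp add: omega_def predual_def o_def)
  then show ?thesis
    using False assms by (auto intro!: predual_P_state product_functional_state \<omega>0)
qed

lemma predual_E_state: "s \<in> initial_times \<Longrightarrow> \<phi> \<in> normal_states M \<Longrightarrow> predual (E s) \<phi> \<in> normal_states MM"
  by (rule predual_slice_state[OF \<omega>_state])

lemma predual_Q: "predual (Q s u) \<phi> = predual (P s u) (predual (E s) \<phi>)"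
  by (simp add: predual_def o_def Q_process_def)

lemma predual_H: "predual (H s u) \<phi> = predual (E u) (predual (P s u) \<phi>)"
  by (simp add: predual_def o_def H_process_def)

lemma predual_Z: "predual (Z s u) \<phi> = predual (H s u) (predual (E s) (predual amp \<phi>))"
  by (simp add: predual_def o_def Z_process_def)

lemma H_amp:
  assumes "0 \<le> s" "s + 1 \<le> u" "x \<in> M"
  shows "H s u (amp x) = P s u x"
  using assms slice_tensor_id[OF \<omega>_state] by (simp add: H_process_def)

lemma amp_bound: "x \<in> M \<Longrightarrow> amp x \<in> MM \<and> norm (amp x) \<le> norm x"
  by (simp add: tensor_op_in_MM M_id norm_tensor_op_id_le M_in_bounded)

lemma E_bound: "s \<in> initial_times \<Longrightarrow> T \<in> MM \<Longrightarrow> E s T \<in> M \<and> norm (E s T) \<le> norm T"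
  using slice_in_M normal_statesD(1) norm_slice_le \<omega>_state by blast

lemma predual_H_state:
  assumes "0 \<le> s" "s + 1 \<le> u" "\<phi> \<in> normal_states MM"
  shows "predual (H s u) \<phi> \<in> normal_states MM"
  unfolding predual_H using assms by (intro predual_E_state predual_P_state) auto

lemma ergodic_P_imp_Q:
  assumes "ergodic_principle {0..} M MM P"
  shows "ergodic_principle initial_times M M Q"
  using assms predual_E_state unfolding ergodic_principle_def predual_Q by auto

text \<open>The intermediate time \<open>s + 1\<close> is an admissible initial time for \<open>Q\<close> for every \<open>s \<ge> 0\<close>, although \<open>s\<close>
  itself need not be.\<close>
lemma ergodic_Q_imp_P:
  assumes erg: "ergodic_principle initial_times M M Q"
  shows "ergodic_principle {0..} M MM P"
  unfolding ergodic_principle_def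
proof (intro ballI)
  fix \<phi> \<psi> and s :: real assume \<phi>: "\<phi> \<in> normal_states MM" and \<psi>: "\<psi> \<in> normal_states MM" and s: "s \<in> {0..}"
  let ?\<tau> = "s + 1"
  let ?\<phi> = "predual (P s ?\<tau>) \<phi>" and ?\<psi> = "predual (P s ?\<tau>) \<psi>"
  have st: "?\<phi> \<in> normal_states M" "?\<psi> \<in> normal_states M"
    using s \<phi> \<psi> by (auto intro: predual_P_state)
  have \<tau>: "?\<tau> \<in> initial_times" using s by auto
  show "((\<lambda>u. functional_norm M (predual (P s u) \<phi> - predual (P s u) \<psi>)) \<longlongrightarrow> 0) at_top"
  proof (rule functional_norm_tendsto_zero[where j="\<lambda>_ x. x" and r="?\<tau> + 1", OF M_bounded M_subspace M_bounded M_subspace])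
    show "((\<lambda>u. functional_norm M (predual (Q ?\<tau> u) ?\<phi> - predual (Q ?\<tau> u) ?\<psi>)) \<longlongrightarrow> 0) at_top"
      using erg st \<tau> unfolding ergodic_principle_def by blast
    fix u assume u: "u \<ge> ?\<tau> + 1"
    show "normal_functional M (predual (P s u) \<phi>)" "normal_functional M (predual (P s u) \<psi>)"
      using s u \<phi> \<psi> by (auto intro!: normal_statesD(1) predual_P_state)
    show "normal_functional M (predual (Q ?\<tau> u) ?\<phi>)" "normal_functional M (predual (Q ?\<tau> u) ?\<psi>)"
      unfolding predual_Q using s u st \<tau>
      by (auto intro!: normal_statesD(1) predual_P_state predual_E_state)
    show "x \<in> M \<and> norm x \<le> norm x \<and> predual (P s u) \<phi> x = predual (Q ?\<tau> u) ?\<phi> x \<and>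
      predual (P s u) \<psi> x = predual (Q ?\<tau> u) ?\<psi> x" if "x \<in> M" for x
      using that s u P_evolution[of s ?\<tau> u x] by (simp add: predual_def)
  qed
qed

lemma ergodic_P_imp_H:
  assumes erg: "ergodic_principle {0..} M MM P"
  shows "ergodic_principle {0..} MM MM H"
  unfolding ergodic_principle_def
proof (intro ballI)
  fix \<phi> \<psi> and s :: real assume \<phi>: "\<phi> \<in> normal_states MM" and \<psi>: "\<psi> \<in> normal_states MM" and s: "s \<in> {0..}"
  show "((\<lambda>u. functional_norm MM (predual (H s u) \<phi> - predual (H s u) \<psi>)) \<longlongrightarrow> 0) at_top"
  proof (rule functional_norm_tendsto_zero[where j=E and r="s + 1", OF MM_bounded MM_subspace M_bounded M_subspace])
    show "((\<lambda>u. functional_norm M (predual (P s u) \<phi> - predual (P s u) \<psi>)) \<longlongrightarrow> 0) at_top"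
      using erg \<phi> \<psi> s unfolding ergodic_principle_def by blast
    fix u assume u: "u \<ge> s + 1"
    show "normal_functional M (predual (P s u) \<phi>)" "normal_functional M (predual (P s u) \<psi>)"
      using s u \<phi> \<psi> by (auto intro!: normal_statesD(1) predual_P_state)
    show "normal_functional MM (predual (H s u) \<phi>)" "normal_functional MM (predual (H s u) \<psi>)"
      using s u \<phi> \<psi> by (auto intro!: normal_statesD(1) predual_H_state)
    show "E u T \<in> M \<and> norm (E u T) \<le> norm T \<and> predual (H s u) \<phi> T = predual (P s u) \<phi> (E u T) \<and>
      predual (H s u) \<psi> T = predual (P s u) \<psi> (E u T)" if "T \<in> MM" for T
      using E_bound[of u T] that s u by (simp add: predual_H) (simp add: predual_def)
  qed
qed

lemma ergodic_H_imp_P: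
  assumes erg: "ergodic_principle {0..} MM MM H"
  shows "ergodic_principle {0..} M MM P"
  unfolding ergodic_principle_def
proof (intro ballI)
  fix \<phi> \<psi> and s :: real assume \<phi>: "\<phi> \<in> normal_states MM" and \<psi>: "\<psi> \<in> normal_states MM" and s: "s \<in> {0..}"
  show "((\<lambda>u. functional_norm M (predual (P s u) \<phi> - predual (P s u) \<psi>)) \<longlongrightarrow> 0) at_top"
  proof (rule functional_norm_tendsto_zero[where j="\<lambda>_. amp" and r="s + 1", OF M_bounded M_subspace MM_bounded MM_subspace])
    show "((\<lambda>u. functional_norm MM (predual (H s u) \<phi> - predual (H s u) \<psi>)) \<longlongrightarrow> 0) at_top"
      using erg \<phi> \<psi> s unfolding ergodic_principle_def by blast
    fix u assume u: "u \<ge> s + 1"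
    show "normal_functional M (predual (P s u) \<phi>)" "normal_functional M (predual (P s u) \<psi>)"
      using s u \<phi> \<psi> by (auto intro!: normal_statesD(1) predual_P_state)
    show "normal_functional MM (predual (H s u) \<phi>)" "normal_functional MM (predual (H s u) \<psi>)"
      using s u \<phi> \<psi> by (auto intro!: normal_statesD(1) predual_H_state)
    show "amp x \<in> MM \<and> norm (amp x) \<le> norm x \<and> predual (P s u) \<phi> x = predual (H s u) \<phi> (amp x) \<and>
      predual (P s u) \<psi> x = predual (H s u) \<psi> (amp x)" if "x \<in> M" for x
      using amp_bound[OF that] H_amp[of s u x] that s u by (simp add: predual_def)
  qed
qed

lemma ergodic_H_imp_Z:
  assumes "ergodic_principle {0..} MM MM H"
  shows "ergodic_principle initial_times MM MM Z"
  using assms predual_E_state predual_tensor_id_state unfolding ergodic_principle_def predual_Z by auto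

text \<open>A state \<open>\<phi>\<close> of \<open>M\<close> is extended to \<open>\<phi> \<circ> E 0\<close>, which restricts to \<open>\<phi>\<close> on \<open>M \<otimes> 1\<close>.\<close>
lemma ergodic_Z_imp_Q:
  assumes erg: "ergodic_principle initial_times MM MM Z"
  shows "ergodic_principle initial_times M M Q"
  unfolding ergodic_principle_def
proof (intro ballI)
  fix \<phi> \<psi> and s :: real assume \<phi>: "\<phi> \<in> normal_states M" and \<psi>: "\<psi> \<in> normal_states M" and s: "s \<in> initial_times"
  let ?\<phi> = "predual (E 0) \<phi>" and ?\<psi> = "predual (E 0) \<psi>"
  have st: "?\<phi> \<in> normal_states MM" "?\<psi> \<in> normal_states MM"
    using \<phi> \<psi> by (auto intro: predual_E_state)
  show "((\<lambda>u. functional_norm M (predual (Q s u) \<phi> - predual (Q s u) \<psi>)) \<longlongrightarrow> 0) at_top"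
  proof (rule functional_norm_tendsto_zero[where j="\<lambda>_. amp" and r="s + 1", OF M_bounded M_subspace MM_bounded MM_subspace])
    show "((\<lambda>u. functional_norm MM (predual (Z s u) ?\<phi> - predual (Z s u) ?\<psi>)) \<longlongrightarrow> 0) at_top"
      using erg st s unfolding ergodic_principle_def by blast
    fix u assume u: "u \<ge> s + 1"
    have s0: "0 \<le> s" using s by auto
    show "normal_functional M (predual (Q s u) \<phi>)" "normal_functional M (predual (Q s u) \<psi>)"
      unfolding predual_Q using s s0 u \<phi> \<psi>
      by (auto intro!: normal_statesD(1) predual_P_state predual_E_state)
    show "normal_functional MM (predual (Z s u) ?\<phi>)" "normal_functional MM (predual (Z s u) ?\<psi>)"
      unfolding predual_Z using s s0 u st
      by (auto intro!: normal_statesD(1) predual_H_state predual_E_state predual_tensor_id_state)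
    have key: "E 0 (Z s u (amp x)) = Q s u x" if "x \<in> M" for x
    proof -
      have "Q s u x \<in> M"
        using E_bound[OF s P_in[OF s0 u that]] by (simp add: Q_process_def)
      then show ?thesis
        using H_amp[OF s0 u that] slice_tensor_id[OF \<omega>_state[of 0]] by (simp add: Z_process_def Q_process_def)
    qed
    show "amp x \<in> MM \<and> norm (amp x) \<le> norm x \<and> predual (Q s u) \<phi> x = predual (Z s u) ?\<phi> (amp x) \<and>
      predual (Q s u) \<psi> x = predual (Z s u) ?\<psi> (amp x)" if "x \<in> M" for x
      using amp_bound[OF that] key[OF that] by (simp add: predual_def)
  qed
qed

end

theorem corollary3p5:
  fixes t :: "'h::complex_hilbert_space \<Rightarrow> 'h \<Rightarrow> 't::complex_hilbert_space"
    and M :: "('h \<Rightarrow>\<^sub>L 'h) set"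
    and P :: "real \<Rightarrow> real \<Rightarrow> ('h \<Rightarrow>\<^sub>L 'h) \<Rightarrow> ('t \<Rightarrow>\<^sub>L 't)"
    and \<omega>0 :: "('h \<Rightarrow>\<^sub>L 'h) \<Rightarrow> complex"
  assumes "hilbert_tensor t"
    and "von_neumann_algebra M"
    and "qqsp_A t M P \<omega>0"
  shows "(ergodic_principle {0..} M (vn_tensor t M M) P
        \<longleftrightarrow> ergodic_principle ({0} \<union> {1..}) M M (Q_process t M P \<omega>0)) \<and>
    (ergodic_principle ({0} \<union> {1..}) M M (Q_process t M P \<omega>0)
        \<longleftrightarrow> ergodic_principle {0..} (vn_tensor t M M) (vn_tensor t M M) (H_process t M P \<omega>0)) \<and>
    (ergodic_principle {0..} (vn_tensor t M M) (vn_tensor t M M) (H_process t M P \<omega>0)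
        \<longleftrightarrow> ergodic_principle ({0} \<union> {1..}) (vn_tensor t M M) (vn_tensor t M M)
              (Z_process t M P \<omega>0))"
proof -
  interpret quadratic_process t M P \<omega>0
    by unfold_locales (fact assms)+
  show ?thesis
    using ergodic_P_imp_Q ergodic_Q_imp_P ergodic_P_imp_H ergodic_H_imp_P ergodic_H_imp_Z ergodic_Z_imp_Q
    by blast
qed

end
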